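(* Let $\mathcal{M}_h$ be a triangulated closed reference surface, $\alpha\ge0$ a constant, $0=t_0<t_1<\dots<t_M=T$ a partition with $\tau_m=t_m-t_{m-1}$, and let $\Gamma_h^0$ be a closed polyhedral surface parameterized by $\vec{X}_h^0\in S(\mathcal{M}_h)^3$. Let the closed polyhedral surfaces $\Gamma_h^m$, parameterized by $\vec{X}_h^m\in S(\mathcal{M}_h)^3$, be produced by the following scheme for surface diffusion. For $m\ge1$: $\vec{u}_h^{m+1}\in S(\hat\Gamma_h^{m+1/2})^3$, $H_h^{m+1/2}\in S(\hat\Gamma_h^{m+1/2})$, $\lambda_h^{m+1}\in\mathbb{R}$ satisfy, for all $\vec{\xi}_h\in S(\hat\Gamma_h^{m+1/2})^3$ and $\eta_h\in S(\hat\Gamma_h^{m+1/2})$, $$ \left\{ \begin{aligned} &\Big(\tfrac{\vec{u}_h^{m+1}-\vec{u}_h^m}{\tau_{m+1}},\vec{\xi}_h\Big)^h_{\hat\Gamma_h^{m+1/2}} +\alpha\Big(\nabla_{\mathcal{M}_h} \vec{X}_h^{m+1/2},\nabla_{\mathcal{M}_h}\mathcal{I}_h\big((\mathbb{P}_{h}^{m+1/2}\vec{\xi}_h)\circ \hat{X}_h^{m+1/2}\big)\Big)_{\mathcal{M}_h}\\ &\qquad+\lambda_h^{m+1}\Big(\nabla_{\hat\Gamma_h^{m+1/2}} H_h^{m+1/2},\nabla_{\hat\Gamma_h^{m+1/2}}\mathcal{I}_h\Big[\tfrac{\vec{\xi}_h\cdot\pi_h\bar{n}_h^{m+1/2}}{|\pi_h\bar{n}_h^{m+1/2}|^2}\Big]\Big)_{\hat\Gamma_h^{m+1/2}}=0,\\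 &\Big(\nabla_{\hat\Gamma_h^{m+1/2}}\tfrac{\vec{u}_h^{m+1}+\vec{u}_h^m}{2}, \nabla_{\hat\Gamma_h^{m+1/2}}\mathcal{I}_h(\eta_h\vec{\nu}_h^{m+1/2})\Big)_{\hat\Gamma_h^{m+1/2}}=\Big(H_h^{m+1/2},\eta_h\Big)^h_{\hat\Gamma_h^{m+1/2}},\\ &\frac{|\Gamma_h^{m+1}|-|\Gamma_h^m|}{\tau_{m+1}}+\Big(\nabla_{\hat\Gamma_h^{m+1/2}}H_h^{m+1/2},\nabla_{\hat\Gamma_h^{m+1/2}}H_h^{m+1/2}\Big)_{\hat\Gamma_h^{m+1/2}}=0, \end{aligned} \right. $$ where $\vec{u}_h^{m}:=\vec{X}_h^{m}\circ(\hat{X}_h^{m+1/2})^{-1}$ and $\vec{X}_h^{m+1}:=\vec{u}_h^{m+1}\circ\hat{X}_h^{m+1/2}$. For $m=0$: $\vec{u}_h^1\in S(\Gamma_h^{1/2})^3$, $H_h^{1/2}\in S(\Gamma_h^{1/2})$, $\lambda_h^1\in\mathbb{R}$ satisfy the same system with $m=0$ in which $\hat\Gamma_h^{1/2}$ and $\hat X_h^{1/2}$ are replaced by the unknown surface $\Gamma_h^{1/2}$ and its parameterization $\vec X_h^{1/2}=\frac12(\vec X_h^0+\vec X_h^1)$, i.e. for all $\vec{\xi}_h\in S(\Gamma_h^{1/2})^3$, $\eta_h\in S(\Gamma_h^{1/2})$, $$ \left\{ \begin{aligned} &\Big(\tfrac{\vec{u}_h^{1}-\vec{u}_h^0}{\tau_{1}}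 ,\vec{\xi}_h\Big)^h_{\Gamma_h^{1/2}}+ \lambda_h^1\Big(\nabla_{\Gamma_h^{1/2}} H_h^{1/2},\nabla_{\Gamma_h^{1/2}}\mathcal{I}_h\Big[\tfrac{\vec{\xi}_h\cdot\pi_h\bar{n}_h^{1/2}}{|\pi_h\bar{n}_h^{1/2}|^2}\Big]\Big)_{\Gamma_h^{1/2}}\\ &\qquad+\alpha\Big(\nabla_{\mathcal{M}_h} \vec{X}_h^{1/2}, \nabla_{\mathcal{M}_h}\mathcal{I}_h\big((\mathbb{P}_h^{1/2}\vec{\xi}_h)\circ \vec{X}_h^{1/2}\big)\Big)_{\mathcal{M}_h}=0, \\ &\tfrac{1}{2}\Big(\nabla_{\Gamma_h^{1/2}}(\vec{u}_h^{1}+\vec{u}_h^0), \nabla_{\Gamma_h^{1/2}}\mathcal{I}_h(\eta_h\vec{\nu}_h^{1/2})\Big)_{\Gamma_h^{1/2}}-\Big(H_h^{1/2},\eta_h\Big)^h_{\Gamma_h^{1/2}}=0 ,\\ &\frac{|\Gamma_h^{1}|-|\Gamma_h^0|}{\tau_{1}}+\Big(\nabla_{\Gamma_h^{1/2}}H_h^{1/2},\nabla_{\Gamma_h^{1/2}}H_h^{1/2}\Big)_{\Gamma_h^{1/2}}=0, \end{aligned} \right. $$ with $\vec{u}_h^{j}=\vec{X}_h^{j}\circ(\vec{X}_h^{1/2})^{-1}$ for $j=0,1$. Let $V_h^m$ denote the volume enclosed by $\Gamma_h^m$. Then $$V_h^{m+1}=V_h^{m}=\cdots=V_h^1=V_h^0\quad\text{and}\quad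 |\Gamma_h^{m+1}|\le |\Gamma_h^{m}|\le \cdots\le|\Gamma_h^1|\le |\Gamma_h^0|.$$
   Context: For a closed polyhedral surface $\mathcal{N}_h=\bigcup_k T_k\subset\mathbb{R}^3$ made of (flat) triangles, $S(\mathcal{N}_h)$ is the space of continuous functions linear on each triangle and $W(\mathcal{N}_h)$ the space of functions constant on each triangle. $\mathcal{I}_h$ is the continuous piecewise linear nodal interpolation operator at the vertices. $|\mathcal N_h|$ is the area, $\nabla_{\mathcal N_h}$ the (elementwise) surface gradient, $(\cdot,\cdot)_{\mathcal{N}_h}$ the $L^2$-inner product (Frobenius product for matrix-valued functions), and the mass-lumped inner product is $(f_h,g_h)^h_{\mathcal{N}_h}=\frac13\sum_{T\in\mathcal{N}_h}|T|\sum_{j=1}^3 f_h(p_j)g_h(p_j)$, with $p_1,p_2,p_3$ the vertices of $T$ (dot product for vectors, values taken from within $T$). The projection $\pi_h:W(\mathcal{N}_h)^3\to S(\mathcal{N}_h)^3$ is defined by $(\pi_h\vec{\chi}_h,\vec{\xi}_h)^h_{\mathcal{N}_h}=(\vec{\chi}_h,\vec{\xi}_h)_{\mathcal{N}_h}$ for all $\vec{\xi}_h\in S(\mathcal{N}_h)^3$ (here $\mathcal N_h$ is $\hat\Gamma_h^{m+1/2}$ for $m\ge1$, resp. $\Gamma_h^{1/2}$ for $m=0$). The weighted unit outward normal of a closed polyhedral surface is the element of $S(\mathcal{N}_h)^3$ with nodal values $\pi_h\vec{n}_h(p_j)/|\pi_h\vec{n}_h(p_j)|$, where $\vec{n}_h\in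 W(\mathcal{N}_h)^3$ is the piecewise constant unit outward normal. All surfaces are images of the same triangulation $\mathcal{M}_h$ under continuous piecewise linear parameterizations. $\Gamma_h^m=\bigcup_kT_k^m$ is the image of $\vec X_h^m$; $\Gamma_h^{m+1/2}=\bigcup_kT_k^{m+1/2}$ is the image of $\vec{X}_h^{m+1/2}:=\frac12(\vec{X}_h^m+\vec{X}_h^{m+1})$, $m\ge0$; $\hat\Gamma_h^{m+1/2}=\bigcup_k\hat T_k^{m+1/2}$ is the image of the extrapolation $\hat{X}_h^{m+1/2}:=\vec{X}_h^m+\frac{\tau_{m+1}}{2\tau_m}(\vec{X}_h^m-\vec{X}_h^{m-1})$, $m\ge1$. For a triangle $T$ with vertices $p_1,p_2,p_3$ ordered counterclockwise when viewed from the outward normal direction, $\mathcal{J}(T)=(p_2-p_1)\times(p_3-p_1)$; put $\mathcal{J}_k^m=\mathcal{J}(T_k^m)$, $\mathcal{J}_k^{m+1/2}=\mathcal{J}(T_k^{m+1/2})$, $\hat{\mathcal{J}}_k^{m+1/2}=\mathcal{J}(\hat T_k^{m+1/2})$. The averaged-in-time normals are the piecewise constant vector fields $$\bar{n}_h^{m+1/2}\big|_{\hat T_k^{m+1/2}}=\frac{\mathcal{J}_k^m+4\mathcal{J}_k^{m+1/2}+\mathcal{J}_k^{m+1}}{6|\hat{\mathcal{J}}_k^{m+1/2}|}\ (m\ge1),\qquad \bar{n}_h^{1/2}\big|_{T_k^{1/2}}=\frac{\mathcal{J}_k^0+4\mathcal{J}_k^{1/2}+\mathcal{J}_k^{1}}{6|\mathcal{J}_k^{1/2}|}.$$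 $\vec{\nu}_h^{m+1/2}$ is the weighted unit outward normal of $\Gamma_h^{m+1/2}$, for $m\ge 1$ lifted to $\hat\Gamma_h^{m+1/2}$ (same nodal values at corresponding vertices); $\hat{\nu}_h^{m+1/2}\in S(\hat\Gamma_h^{m+1/2})^3$ is the weighted unit outward normal of $\hat\Gamma_h^{m+1/2}$. With $I$ the $3\times 3$ identity, $$\mathbb{P}_h^{m+1/2}=(\hat{\nu}_h^{m+1/2}\cdot\pi_h\bar{n}_h^{m+1/2})I-(\pi_h\bar{n}_h^{m+1/2})(\hat{\nu}_h^{m+1/2})^T\ (m\ge1),\qquad \mathbb{P}_h^{1/2}=(\vec{\nu}_h^{1/2}\cdot\pi_h\bar{n}_h^{1/2})I-(\pi_h\bar{n}_h^{1/2})(\vec{\nu}_h^{1/2})^T.$$ It is implicit that all quantities appearing in the scheme are well defined (non-degenerate triangles, nonzero nodal values of the projected normals). *)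

theory Defs
  imports "HOL-Analysis.Analysis"
begin

section \<open>Triangles and closed polyhedral surfaces\<close>

text \<open>A triangle is an ordered triple \<open>T $ 1, T $ 2, T $ 3\<close> of points; indices of type \<open>3\<close> are cyclic
  (\<open>3 + 1 = 1\<close>). A triangulated surface is a family of such triangles over a finite index type.\<close>

type_synonym triangle = "real^3^3"
type_synonym 'k trisurf = "'k \<Rightarrow> triangle"

definition verts :: "triangle \<Rightarrow> (real^3) set" where
  "verts T = {T $ 1, T $ 2, T $ 3}"

definition tri :: "triangle \<Rightarrow> (real^3) set" where
  "tri T = convex hull (verts T)"

definition orient_vec :: "triangle \<Rightarrow> real^3" where
  "orient_vec T = cross3 (T $ 2 - T $ 1) (T $ 3 - T $ 1)"

definition tri_area :: "triangle \<Rightarrow> real" where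
  "tri_area T = norm (orient_vec T) / 2"

definition directed_edge :: "triangle \<Rightarrow> real^3 \<Rightarrow> real^3 \<Rightarrow> bool" where
  "directed_edge T a b \<longleftrightarrow> (\<exists>j::3. a = T $ j \<and> b = T $ (j + 1))"

definition vertices :: "'k trisurf \<Rightarrow> (real^3) set" where
  "vertices N = (\<Union>k. verts (N k))"

definition surface :: "'k trisurf \<Rightarrow> (real^3) set" where
  "surface N = (\<Union>k. tri (N k))"

definition area :: "'k::finite trisurf \<Rightarrow> real" where
  "area N = (\<Sum>k\<in>UNIV. tri_area (N k))"

text \<open>Closed triangulated surface: non-degenerate distinct triangles without hanging nodes, every
  edge shared by exactly two triangles (which, the vertex orderings being chosen consistently,
  traverse it in opposite directions), and the triangles around each vertex forming a single
  cycle.\<close>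

definition closed_polyhedral :: "'k::finite trisurf \<Rightarrow> bool" where
  "closed_polyhedral N \<longleftrightarrow>
     (\<forall>k. \<not> collinear (verts (N k))) \<and>
     (\<forall>k l. k \<noteq> l \<longrightarrow> verts (N k) \<noteq> verts (N l) \<and>
        tri (N k) \<inter> tri (N l) = convex hull (verts (N k) \<inter> verts (N l))) \<and>
     (\<forall>k a b. directed_edge (N k) a b \<longrightarrow> (\<exists>!l. directed_edge (N l) b a)) \<and>
     (\<forall>p k l. p \<in> verts (N k) \<and> p \<in> verts (N l) \<longrightarrow>
        (k, l) \<in> {(i, j). p \<in> verts (N i) \<inter> verts (N j) \<and>
                          2 \<le> card (verts (N i) \<inter> verts (N j))}\<^sup>*)"

text \<open>The vertices of every triangle are ordered counterclockwise as seen from the exterior, i.e.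
  \<open>orient_vec\<close> points from the bounded into the unbounded part of the complement.\<close>

definition outward_ordered :: "'k trisurf \<Rightarrow> bool" where
  "outward_ordered N \<longleftrightarrow>
     (\<forall>k. \<forall>x\<in>rel_interior (tri (N k)). \<forall>\<^sub>F e in at_right (0::real).
        x + e *\<^sub>R orient_vec (N k) \<in> outside (surface N) \<and>
        x - e *\<^sub>R orient_vec (N k) \<in> inside (surface N))"

definition enclosed_volume :: "'k trisurf \<Rightarrow> real" where
  "enclosed_volume N = measure lebesgue (inside (surface N))"


section \<open>Finite element spaces, inner products, operators\<close>

text \<open>Functions on a surface are total functions on \<open>\<real>\<^sup>3\<close> of which only the values on the surface
  matter. With scalar values this is \<open>S(N)\<close>, with values in \<open>\<real>\<^sup>3\<close> it is \<open>S(N)\<^sup>3\<close>.\<close>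

definition pw_linear :: "'k trisurf \<Rightarrow> (real^3 \<Rightarrow> 'b::real_normed_vector) set" where
  "pw_linear N = {f. continuous_on (surface N) f \<and>
     (\<forall>k. \<forall>x\<in>tri (N k). \<forall>y\<in>tri (N k). \<forall>s\<in>{0..1}.
        f ((1 - s) *\<^sub>R x + s *\<^sub>R y) = (1 - s) *\<^sub>R f x + s *\<^sub>R f y)}"

definition interp :: "'k trisurf \<Rightarrow> (real^3 \<Rightarrow> 'b::real_normed_vector) \<Rightarrow> real^3 \<Rightarrow> 'b" where
  "interp N f = (SOME g. g \<in> pw_linear N \<and> (\<forall>p\<in>vertices N. g p = f p))"

text \<open>Surface integral over a flat triangle through its affine parameterization; the Jacobian
  factor is constant.\<close>

definition tri_integral :: "triangle \<Rightarrow> (real^3 \<Rightarrow> real) \<Rightarrow> real" where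
  "tri_integral T f = norm (orient_vec T) *
     integral {(s::real, t::real). 0 \<le> s \<and> 0 \<le> t \<and> s + t \<le> 1}
       (\<lambda>(s, t). f (T $ 1 + s *\<^sub>R (T $ 2 - T $ 1) + t *\<^sub>R (T $ 3 - T $ 1)))"

text \<open>The arguments of the \<open>L\<^sup>2\<close>-product are elementwise fields: on the \<open>k\<close>-th triangle the field is
  \<open>f k\<close>. The inner product of the type \<open>real^3^3\<close> is the Frobenius product.\<close>

definition L2_prod ::
    "'k::finite trisurf \<Rightarrow> ('k \<Rightarrow> real^3 \<Rightarrow> 'b::real_inner) \<Rightarrow> ('k \<Rightarrow> real^3 \<Rightarrow> 'b) \<Rightarrow> real" where
  "L2_prod N f g = (\<Sum>k\<in>UNIV. tri_integral (N k) (\<lambda>x. f k x \<bullet> g k x))"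

text \<open>The mass-lumped product is only applied to continuous functions.\<close>

definition lumped_prod ::
    "'k::finite trisurf \<Rightarrow> (real^3 \<Rightarrow> 'b::real_inner) \<Rightarrow> (real^3 \<Rightarrow> 'b) \<Rightarrow> real" where
  "lumped_prod N f g =
     1/3 * (\<Sum>k\<in>UNIV. tri_area (N k) * (\<Sum>j\<in>UNIV. f (N k $ j) \<bullet> g (N k $ j)))"

text \<open>Tangential gradient on a flat triangle: the derivative along the triangle, represented by a
  vector orthogonal to the normal.\<close>

definition tri_grad :: "triangle \<Rightarrow> (real^3 \<Rightarrow> real) \<Rightarrow> real^3 \<Rightarrow> real^3" where
  "tri_grad T f x = (THE g. g \<bullet> orient_vec T = 0 \<and>
     (f has_derivative (\<lambda>h. g \<bullet> h)) (at x within tri T))"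

definition grad :: "'k trisurf \<Rightarrow> (real^3 \<Rightarrow> real) \<Rightarrow> 'k \<Rightarrow> real^3 \<Rightarrow> real^3" where
  "grad N f k x = tri_grad (N k) f x"

definition grad_vec :: "'k trisurf \<Rightarrow> (real^3 \<Rightarrow> real^3) \<Rightarrow> 'k \<Rightarrow> real^3 \<Rightarrow> real^3^3" where
  "grad_vec N f k x = (\<chi> i. tri_grad (N k) (\<lambda>y. f y $ i) x)"

text \<open>Elements of \<open>W(N)\<^sup>3\<close> are given by their value on each triangle.\<close>

definition lumped_proj :: "'k::finite trisurf \<Rightarrow> ('k \<Rightarrow> real^3) \<Rightarrow> real^3 \<Rightarrow> real^3" where
  "lumped_proj N w = (SOME p. p \<in> pw_linear N \<and>
     (\<forall>\<xi>\<in>pw_linear N. lumped_prod N p \<xi> = L2_prod N (\<lambda>k x. w k) (\<lambda>k. \<xi>)))"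

definition unit_normal :: "'k trisurf \<Rightarrow> 'k \<Rightarrow> real^3" where
  "unit_normal N k = (1 / norm (orient_vec (N k))) *\<^sub>R orient_vec (N k)"

definition weighted_normal :: "'k::finite trisurf \<Rightarrow> real^3 \<Rightarrow> real^3" where
  "weighted_normal N = interp N (\<lambda>p.
     (1 / norm (lumped_proj N (unit_normal N) p)) *\<^sub>R lumped_proj N (unit_normal N) p)"


section \<open>Parameterized surfaces and the scheme\<close>

definition image_surf :: "(real^3 \<Rightarrow> real^3) \<Rightarrow> 'k trisurf \<Rightarrow> 'k trisurf" where
  "image_surf X M k = (\<chi> j. X (M k $ j))"

text \<open>\<open>X\<close> parameterizes an embedded polyhedral surface over \<open>M\<close>, on which the vertex orderings
  inherited from \<open>M\<close> are counterclockwise as seen from outside. Injectivity makes the image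
  triangles non-degenerate.\<close>

definition parameterizes :: "'k trisurf \<Rightarrow> (real^3 \<Rightarrow> real^3) \<Rightarrow> bool" where
  "parameterizes M X \<longleftrightarrow>
     X \<in> pw_linear M \<and> inj_on X (surface M) \<and> outward_ordered (image_surf X M)"

definition half_step :: "(nat \<Rightarrow> real^3 \<Rightarrow> real^3) \<Rightarrow> nat \<Rightarrow> real^3 \<Rightarrow> real^3" where
  "half_step X m x = (1/2) *\<^sub>R (X m x + X (m + 1) x)"

definition extrapolation ::
    "(nat \<Rightarrow> real) \<Rightarrow> (nat \<Rightarrow> real^3 \<Rightarrow> real^3) \<Rightarrow> nat \<Rightarrow> real^3 \<Rightarrow> real^3" where
  "extrapolation \<tau> X m x = X m x + (\<tau> (m + 1) / (2 * \<tau> m)) *\<^sub>R (X m x - X (m - 1) x)"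

text \<open>In the following, \<open>Y\<close> parameterizes the surface on which the equations are posed.\<close>

definition avg_normal ::
    "'k trisurf \<Rightarrow> (real^3 \<Rightarrow> real^3) \<Rightarrow> (nat \<Rightarrow> real^3 \<Rightarrow> real^3) \<Rightarrow> nat \<Rightarrow> 'k \<Rightarrow> real^3" where
  "avg_normal M Y X m k =
     (1 / (6 * norm (orient_vec (image_surf Y M k)))) *\<^sub>R
       (orient_vec (image_surf (X m) M k)
        + 4 *\<^sub>R orient_vec (image_surf (half_step X m) M k)
        + orient_vec (image_surf (X (m + 1)) M k))"

text \<open>Pull-back of a function on \<open>M\<close> to the image of \<open>Y\<close>, i.e. \<open>f \<circ> Y\<^sup>-\<^sup>1\<close>.\<close>

definition lift_to ::
    "'k trisurf \<Rightarrow> (real^3 \<Rightarrow> real^3) \<Rightarrow> (real^3 \<Rightarrow> real^3) \<Rightarrow> real^3 \<Rightarrow> real^3" where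
  "lift_to M Y f = f \<circ> inv_into (surface M) Y"

definition proj_matrix :: "real^3 \<Rightarrow> real^3 \<Rightarrow> real^3^3" where
  "proj_matrix \<nu> b = (\<nu> \<bullet> b) *\<^sub>R mat 1 - (\<chi> i j. b $ i * \<nu> $ j)"

text \<open>Nodal values of the projected normals by which the scheme divides.\<close>

definition normals_nonzero ::
    "'k::finite trisurf \<Rightarrow> (real^3 \<Rightarrow> real^3) \<Rightarrow> (nat \<Rightarrow> real^3 \<Rightarrow> real^3) \<Rightarrow> nat \<Rightarrow> bool" where
  "normals_nonzero M Y X m \<longleftrightarrow>
     (let \<Gamma> = image_surf Y M; \<Gamma>h = image_surf (half_step X m) M in
      (\<forall>p\<in>vertices \<Gamma>. lumped_proj \<Gamma> (avg_normal M Y X m) p \<noteq> 0) \<and>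
      (\<forall>p\<in>vertices \<Gamma>. lumped_proj \<Gamma> (unit_normal \<Gamma>) p \<noteq> 0) \<and>
      (\<forall>p\<in>vertices \<Gamma>h. lumped_proj \<Gamma>h (unit_normal \<Gamma>h) p \<noteq> 0))"

text \<open>One time step of size \<open>dt\<close> from \<open>X m\<close> to \<open>X (m + 1)\<close>. The surface \<open>\<Gamma>\<close> is the
  extrapolated one for \<open>m \<ge> 1\<close> and the midpoint surface for \<open>m = 0\<close>; in the latter case
  \<open>\<nu>\<close> and \<open>\<nu>hat\<close> agree.\<close>

definition scheme_step ::
    "'k::finite trisurf \<Rightarrow> real \<Rightarrow> real \<Rightarrow> (real^3 \<Rightarrow> real^3) \<Rightarrow> (nat \<Rightarrow> real^3 \<Rightarrow> real^3) \<Rightarrow> nat \<Rightarrow>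
     (real^3 \<Rightarrow> real^3) \<Rightarrow> (real^3 \<Rightarrow> real) \<Rightarrow> real \<Rightarrow> bool" where
  "scheme_step M \<alpha> dt Y X m unew H lam \<longleftrightarrow>
     (let \<Gamma> = image_surf Y M;
          Xh = half_step X m;
          uold = lift_to M Y (X m);
          nb = lumped_proj \<Gamma> (avg_normal M Y X m);
          \<nu>hat = weighted_normal \<Gamma>;
          \<nu> = interp \<Gamma> (lift_to M Y (weighted_normal (image_surf Xh M) \<circ> Xh))
      in
      unew \<in> pw_linear \<Gamma> \<and>
      (\<forall>x\<in>surface M. X (m + 1) x = unew (Y x)) \<and>
      H \<in> pw_linear \<Gamma> \<and>
      (\<forall>\<xi>\<in>pw_linear \<Gamma>.
         lumped_prod \<Gamma> (\<lambda>x. (1 / dt) *\<^sub>R (unew x - uold x)) \<xi>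
         + \<alpha> * L2_prod M (grad_vec M Xh)
                (grad_vec M (interp M ((\<lambda>x. proj_matrix (\<nu>hat x) (nb x) *v \<xi> x) \<circ> Y)))
         + lam * L2_prod \<Gamma> (grad \<Gamma> H)
                (grad \<Gamma> (interp \<Gamma> (\<lambda>x. (\<xi> x \<bullet> nb x) / (norm (nb x))\<^sup>2))) = 0) \<and>
      (\<forall>\<eta>\<in>pw_linear \<Gamma>.
         L2_prod \<Gamma> (grad_vec \<Gamma> (\<lambda>x. (1/2) *\<^sub>R (unew x + uold x)))
                (grad_vec \<Gamma> (interp \<Gamma> (\<lambda>x. \<eta> x *\<^sub>R \<nu> x)))
         = lumped_prod \<Gamma> H \<eta>) \<and>
      (area (image_surf (X (m + 1)) M) - area (image_surf (X m) M)) / dt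
         + L2_prod \<Gamma> (grad \<Gamma> H) (grad \<Gamma> H) = 0)"

end

theory Submission
  imports Defs
begin

text \<open>Area decreases because the third equation of a step equates its difference quotient with
  minus the square of a norm. For the volume, the enclosed volume of an embedded polyhedral surface
  is the sum of the signed volumes of the tetrahedra spanned by the origin and the triangles: a
  generic ray leaves and enters the interior according to the signs of the tetrahedra. This
  expression is cubic in the vertices, so Simpson's rule computes its increment exactly, and after
  cancellation of the edge terms on the closed surface the increment is the lumped product of
  \<open>X\<^sup>m\<^sup>+\<^sup>1 - X\<^sup>m\<close> with the projected averaged normal. Testing the first equation with that normal
  shows that it vanishes.\<close>

section \<open>Triangles and conforming surfaces\<close>

text \<open>The volume is the Lebesgue measure of a topologically defined interior, while the
  orientation only describes short normal segments at relative interior points of the triangles. To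
  connect the two, points are discarded whose ray could touch an edge or run parallel to a triangle;
  they fill finitely many planes or smaller subspaces. For every other point off the surface, each
  crossing is transversal, lies inside exactly one triangle and switches sides. In the averaged
  normal, the weights 1, 4, 1 over 6 are those of Simpson's rule for the linear motion from
  \<open>X m\<close> to \<open>X (m + 1)\<close>. Its divisor, the Jacobian of the surface carrying
  the equations, cancels against the triangle areas of the lumped product. A step can therefore be
  analysed on any parameterized surface \<open>Y\<close>, and the implicit first step and the later
  extrapolated steps become one case.\<close>

lemma tri_iff:
  "x \<in> tri T \<longleftrightarrow> (\<exists>u v w. 0 \<le> u \<and> 0 \<le> v \<and> 0 \<le> w \<and> u + v + w = 1 \<and>
     x = u *\<^sub>R T $ 1 + v *\<^sub>R T $ 2 + w *\<^sub>R T $ 3)"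
  unfolding tri_def verts_def convex_hull_3 by blast

lemma verts_eq: "verts T = range (($) T)"
  unfolding verts_def UNIV_3 by auto

lemma vert_in_verts [simp]: "T $ j \<in> verts T"
  by (simp add: verts_eq)

lemma vert_in_tri [simp]: "T $ j \<in> tri T"
  unfolding tri_def by (rule hull_inc) simp

lemma tri_ne [simp]: "tri T \<noteq> {}"
  using vert_in_tri by blast

lemma convex_tri: "convex (tri T)"
  by (simp add: tri_def)

lemma compact_tri: "compact (tri T)"
  unfolding tri_def verts_def by (intro compact_convex_hull finite_imp_compact) simp

lemma compact_surface: "compact (surface (N :: 'k::finite trisurf))"
  unfolding surface_def by (intro compact_UN) (simp_all add: compact_tri)

lemma tri_subset_surface: "tri (N k) \<subseteq> surface N"
  unfolding surface_def by blast

lemma vert_in_surface [simp]: "N k $ j \<in> surface N"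
  using subsetD[OF tri_subset_surface vert_in_tri] .

lemma vert_in_vertices [simp]: "N k $ j \<in> vertices N"
  unfolding vertices_def using vert_in_verts by blast

lemma vertices_iff: "p \<in> vertices N \<longleftrightarrow> (\<exists>k j. p = N k $ j)"
  unfolding vertices_def verts_eq by auto

lemma orient_vec_sum:
  "orient_vec T = cross3 (T $ 1) (T $ 2) + cross3 (T $ 2) (T $ 3) + cross3 (T $ 3) (T $ 1)"
  unfolding orient_vec_def by (simp add: cross3_simps)

text \<open>The common value fixes the plane of the triangle, and it is six times the signed volume
  of the tetrahedron over the triangle with apex at the origin. This double role links ray crossings
  to volumes.\<close>

lemma orient_vec_inner_vert: "orient_vec T \<bullet> T $ j = T $ 1 \<bullet> cross3 (T $ 2) (T $ 3)"
proof -
  have "orient_vec T \<bullet> T $ 1 = T $ 1 \<bullet> cross3 (T $ 2) (T $ 3)"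
    "orient_vec T \<bullet> T $ 2 = T $ 1 \<bullet> cross3 (T $ 2) (T $ 3)"
    "orient_vec T \<bullet> T $ 3 = T $ 1 \<bullet> cross3 (T $ 2) (T $ 3)"
    unfolding orient_vec_def by (simp_all add: cross3_simps)
  then show ?thesis using exhaust_3[of j] by auto
qed

lemma orient_vec_inner_tri:
  assumes "x \<in> tri T"
  shows "orient_vec T \<bullet> x = T $ 1 \<bullet> cross3 (T $ 2) (T $ 3)"
proof -
  obtain u v w where uvw: "u + v + w = 1" "x = u *\<^sub>R T $ 1 + v *\<^sub>R T $ 2 + w *\<^sub>R T $ 3"
    using assms tri_iff by blast
  have "orient_vec T \<bullet> x = (u + v + w) * (T $ 1 \<bullet> cross3 (T $ 2) (T $ 3))"
    unfolding uvw(2) by (simp add: inner_add_right orient_vec_inner_vert distrib_right)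
  then show ?thesis by (simp add: uvw(1))
qed

lemma orient_vec_ne_0_iff: "orient_vec T \<noteq> 0 \<longleftrightarrow> \<not> collinear (verts T)"
proof -
  have "collinear (verts T) \<longleftrightarrow> collinear {T $ 2, T $ 1, T $ 3}"
    by (simp add: verts_def insert_commute)
  also have "\<dots> \<longleftrightarrow> collinear {0, T $ 2 - T $ 1, T $ 3 - T $ 1}"
    by (rule collinear_3) simp
  finally show ?thesis
    by (simp add: orient_vec_def cross_eq_0)
qed

lemma inj_verts:
  assumes "orient_vec T \<noteq> 0"
  shows "inj (($) T)"
proof -
  have "T $ 1 \<noteq> T $ 2 \<and> T $ 1 \<noteq> T $ 3 \<and> T $ 2 \<noteq> T $ 3"
    using assms unfolding orient_vec_ne_0_iff verts_def collinear_3_eq_affine_dependent by auto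
  then have "\<forall>i j. T $ i = T $ j \<longrightarrow> i = j"
    unfolding forall_3 by auto
  then show ?thesis by (simp add: inj_def)
qed

lemma card_verts: "orient_vec T \<noteq> 0 \<Longrightarrow> card (verts T) = 3"
  by (simp add: verts_eq card_image inj_verts)

text \<open>This is the part of \<open>closed_polyhedral\<close> that is carried over to image
  surfaces. The pairing of edges is used on the reference surface itself.\<close>

definition conforming :: "'k trisurf \<Rightarrow> bool" where
  "conforming N \<longleftrightarrow> (\<forall>k. orient_vec (N k) \<noteq> 0) \<and>
     (\<forall>k l. k \<noteq> l \<longrightarrow> verts (N k) \<noteq> verts (N l) \<and>
        tri (N k) \<inter> tri (N l) = convex hull (verts (N k) \<inter> verts (N l)))"

lemma closed_polyhedral_conforming: "closed_polyhedral N \<Longrightarrow> conforming N"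
  by (simp add: closed_polyhedral_def conforming_def orient_vec_ne_0_iff)

lemma conforming_orient_vec: "conforming N \<Longrightarrow> orient_vec (N k) \<noteq> 0"
  unfolding conforming_def by blast

lemma conforming_Int:
  "conforming N \<Longrightarrow> tri (N k) \<inter> tri (N l) = convex hull (verts (N k) \<inter> verts (N l))"
  by (cases "k = l") (simp_all add: conforming_def tri_def)

text \<open>Distinct triangles have different vertex sets of size three, so they share at most two
  vertices, and the hull of these is at most an edge. A ray that avoids edges thus never meets two
  triangles in one point.\<close>

lemma conforming_overlap_in_edge:
  assumes N: "conforming N" and "k \<noteq> l" and x: "x \<in> tri (N k)" "x \<in> tri (N l)"
  obtains a b where "a \<in> verts (N k)" "b \<in> verts (N k)" "x \<in> convex hull {a, b}"
proof -
  let ?I = "verts (N k) \<inter> verts (N l)"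
  have c: "card (verts (N k)) = 3" "card (verts (N l)) = 3"
    by (simp_all add: card_verts conforming_orient_vec[OF N])
  then have f: "finite (verts (N k))" "finite (verts (N l))"
    by (auto intro: card_ge_0_finite)
  have ne: "verts (N k) \<noteq> verts (N l)"
    using N \<open>k \<noteq> l\<close> by (simp add: conforming_def)
  have "?I \<subset> verts (N k)"
  proof (rule ccontr)
    assume "\<not> ?I \<subset> verts (N k)"
    then have "verts (N k) \<subseteq> verts (N l)" by blast
    then show False using card_subset_eq[OF f(2)] c ne by auto
  qed
  then have "card ?I < 3" using psubset_card_mono[OF f(1)] c by metis
  moreover have xI: "x \<in> convex hull ?I" using conforming_Int[OF N] x by blast
  then have "?I \<noteq> {}" by auto
  then have "card ?I \<noteq> 0" using f by auto
  ultimately have "card ?I = 1 \<or> card ?I = 2" by linarith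
  then have "\<exists>a b. ?I = {a, b}"
    by (auto simp: card_1_singleton_iff card_2_iff)
  then obtain a b where ab: "?I = {a, b}" by blast
  then have "a \<in> verts (N k)" "b \<in> verts (N k)" by auto
  then show thesis using that xI ab by simp
qed

text \<open>A vanishing barycentric weight would put \<open>x\<close> into the span of the other two
  vertices. Spans replace edges because they are invariant under the scaling that moves a point
  along its ray.\<close>

lemma rel_interior_tri:
  assumes nd: "orient_vec T \<noteq> 0" and x: "x \<in> tri T"
    and off: "\<And>a b. a \<in> verts T \<Longrightarrow> b \<in> verts T \<Longrightarrow> x \<notin> span {a, b}"
  shows "x \<in> rel_interior (tri T)"
proof -
  obtain u v w where uvw: "0 \<le> u" "0 \<le> v" "0 \<le> w" "u + v + w = 1"
    and xe: "x = u *\<^sub>R T $ 1 + v *\<^sub>R T $ 2 + w *\<^sub>R T $ 3"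
    using x tri_iff by blast
  have sp: "c *\<^sub>R a + d *\<^sub>R b \<in> span {a, b}" for a b :: "real^3" and c d
    by (intro span_add span_mul span_base) auto
  have "u \<noteq> 0" using off[of "T $ 2" "T $ 3"] sp xe by auto
  moreover have "v \<noteq> 0" using off[of "T $ 1" "T $ 3"] sp xe by auto
  moreover have "w \<noteq> 0" using off[of "T $ 1" "T $ 2"] sp xe by auto
  ultimately have pos: "u > 0" "v > 0" "w > 0" using uvw by auto
  have inj: "inj (($) T)" by (rule inj_verts[OF nd])
  have "\<not> affine_dependent (verts T)"
    using nd unfolding orient_vec_ne_0_iff verts_def collinear_3_eq_affine_dependent by blast
  then have "rel_interior (tri T) =
      {y. \<exists>u. (\<forall>x \<in> verts T. 0 < u x) \<and> sum u (verts T) = 1 \<and> (\<Sum>x\<in>verts T. u x *\<^sub>R x) = y}"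
    unfolding tri_def by (rule rel_interior_convex_hull_explicit)
  moreover define f where "f p = (if p = T $ 1 then u else if p = T $ 2 then v else w)" for p
  have ne: "T $ 1 \<noteq> T $ 2" "T $ 1 \<noteq> T $ 3" "T $ 2 \<noteq> T $ 3"
    using inj by (auto dest: injD)
  then have "sum f (verts T) = 1" "(\<Sum>x\<in>verts T. f x *\<^sub>R x) = x" "\<forall>x\<in>verts T. 0 < f x"
    using uvw pos by (auto simp: verts_def f_def xe)
  ultimately show ?thesis by blast
qed

section \<open>The enclosed volume as a sum of signed tetrahedra\<close>

text \<open>Passing a crossing \<open>c\<close> lowers the indicator of \<open>A\<close> by
  \<open>\<sigma> c\<close>, and the indicator is eventually 0, so the sum telescopes. The induction
  is on the number of crossings beyond \<open>t\<close> and restarts just after the first of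
  them.\<close>

lemma crossing_sum:
  fixes \<sigma> :: "real \<Rightarrow> real"
  assumes C: "finite C"
    and const: "\<And>s t. a \<le> s \<Longrightarrow> s \<le> t \<Longrightarrow> {s..t} \<inter> C = {} \<Longrightarrow> s \<in> A \<longleftrightarrow> t \<in> A"
    and jump: "\<And>c. c \<in> C \<Longrightarrow>
      (\<sigma> c = 1 \<and> (\<forall>\<^sub>F s in at_left c. s \<in> A) \<and> (\<forall>\<^sub>F s in at_right c. s \<notin> A)) \<or>
      (\<sigma> c = -1 \<and> (\<forall>\<^sub>F s in at_left c. s \<notin> A) \<and> (\<forall>\<^sub>F s in at_right c. s \<in> A))"
    and bdd: "\<And>s. s \<ge> b \<Longrightarrow> s \<notin> A"
    and t: "a \<le> t" "t \<notin> C"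
  shows "(of_bool (t \<in> A) :: real) = (\<Sum>c\<in>{c \<in> C. t < c}. \<sigma> c)"
  using t
proof (induction "card {c \<in> C. t < c}" arbitrary: t rule: less_induct)
  case less
  let ?D = "{c \<in> C. t < c}"
  have fD: "finite ?D" using C by simp
  show ?case
  proof (cases "?D = {}")
    case True
    have "{t..max t b} \<inter> C = {}"
    proof (intro equals0I)
      fix d assume d: "d \<in> {t..max t b} \<inter> C"
      then have "t < d" using less.prems by (cases "d = t") auto
      then show False using d True by blast
    qed
    then have "t \<notin> A" using const[of t "max t b"] bdd[of "max t b"] less.prems by auto
    then show ?thesis by (simp only: True sum.empty) simp
  next
    case False
    define c where "c = Min ?D"
    have c: "c \<in> C" "t < c" using Min_in[OF fD False] by (auto simp: c_def)
    have cmin: "c \<le> d" if "d \<in> C" "t < d" for d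
      using Min_le[OF fD] that by (auto simp: c_def)
    let ?E = "{d \<in> C. c < d}"
    have fE: "finite ?E" using C by simp
    \<comment> \<open>The next crossing after \<open>c\<close>, or an arbitrary larger number if
      there is none; either way the open interval from \<open>c\<close> to \<open>e\<close> contains
      no crossing.\<close>
    define e where "e = (if ?E = {} then c + 1 else Min ?E)"
    have ce: "c < e" using Min_in[OF fE] by (auto simp: e_def)
    have emin: "e \<le> d" if "d \<in> C" "c < d" for d
      using Min_le[OF fE] that by (auto simp: e_def)
    have L: "s \<in> A \<longleftrightarrow> t \<in> A" if "t < s" "s < c" for s
    proof -
      have "{t..s} \<inter> C = {}"
      proof (intro equals0I)
        fix d assume d: "d \<in> {t..s} \<inter> C"
        then have "t < d" using less.prems by (cases "d = t") auto
        then show False using d cmin[of d] that by auto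
      qed
      then show ?thesis using const[of t s] that less.prems by simp
    qed
    have evL: "\<forall>\<^sub>F s in at_left c. t < s \<and> s < c"
      using c eventually_at_left[of t c] by (metis (mono_tags, lifting))
    have evR: "\<forall>\<^sub>F s in at_right c. c < s \<and> s < e"
      using ce eventually_at_right[of c e] by (metis (mono_tags, lifting))
    have step: "(of_bool (s \<in> A) :: real) = (\<Sum>d\<in>?E. \<sigma> d)" if s: "c < s" "s < e" for s
    proof -
      have eq: "{d \<in> C. s < d} = ?E" using s emin by (intro Collect_cong) (meson less_le_trans less_trans)
      have "?E \<subseteq> ?D" "c \<in> ?D - ?E" using c by auto
      then have "?E \<subset> ?D" by blast
      then have "card {d \<in> C. s < d} < card ?D" unfolding eq by (rule psubset_card_mono[OF fD])
      moreover have "s \<notin> C" using emin[of s] s by auto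
      ultimately show ?thesis using less.hyps[of s] s c less.prems by (simp only: eq) simp
    qed
    have split: "?D = insert c ?E"
    proof (intro equalityI subsetI)
      fix d assume "d \<in> ?D"
      then show "d \<in> insert c ?E" using cmin[of d] by (cases "d = c") auto
    qed (use c in auto)
    have sum: "(\<Sum>d\<in>?D. \<sigma> d) = \<sigma> c + (\<Sum>d\<in>?E. \<sigma> d)"
      unfolding split using fE by simp
    from jump[OF c(1)] show ?thesis
    proof
      assume h: "\<sigma> c = 1 \<and> (\<forall>\<^sub>F s in at_left c. s \<in> A) \<and> (\<forall>\<^sub>F s in at_right c. s \<notin> A)"
      obtain s where "s \<in> A" "t < s" "s < c"
        using eventually_happens'[OF trivial_limit_at_left_real eventually_conj[OF conjunct1[OF conjunct2[OF h]] evL]] by auto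
      moreover obtain s' where "s' \<notin> A" "c < s'" "s' < e"
        using eventually_happens'[OF trivial_limit_at_right_real eventually_conj[OF conjunct2[OF conjunct2[OF h]] evR]] by auto
      ultimately show ?thesis using L[of s] step[of s'] sum h by simp
    next
      assume h: "\<sigma> c = -1 \<and> (\<forall>\<^sub>F s in at_left c. s \<notin> A) \<and> (\<forall>\<^sub>F s in at_right c. s \<in> A)"
      obtain s where "s \<notin> A" "t < s" "s < c"
        using eventually_happens'[OF trivial_limit_at_left_real eventually_conj[OF conjunct1[OF conjunct2[OF h]] evL]] by auto
      moreover obtain s' where "s' \<in> A" "c < s'" "s' < e"
        using eventually_happens'[OF trivial_limit_at_right_real eventually_conj[OF conjunct2[OF conjunct2[OF h]] evR]] by auto
      ultimately show ?thesis using L[of s] step[of s'] sum h by simp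
    qed
  qed
qed

section \<open>Tetrahedra with apex at the origin\<close>

text \<open>The tetrahedron is the image of the standard simplex, of volume 1/3!, under the linear
  map with columns \<open>a\<close>, \<open>b\<close>, \<open>c\<close>. Degenerate tetrahedra are
  covered, with determinant 0.\<close>

lemma measure_tetrahedron:
  fixes a b c :: "real^3"
  shows "measure lebesgue (convex hull {0, a, b, c}) = \<bar>a \<bullet> cross3 b c\<bar> / 6"
proof -
  define L :: "real^3 \<Rightarrow> real^3" where "L x = x $ 1 *\<^sub>R a + x $ 2 *\<^sub>R b + x $ 3 *\<^sub>R c" for x
  have lin: "linear L"
    by (intro linearI) (simp_all add: L_def algebra_simps)
  have Basis: "Basis = {axis 1 1, axis 2 1, axis 3 1 :: real^3}"
    by (auto simp: Basis_vec_def UNIV_3)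
  let ?B = "insert 0 Basis :: (real^3) set"
  have img: "L ` ?B = {0, a, b, c}"
    unfolding Basis by (simp add: L_def axis_def)
  have "convex hull ?B \<in> lmeasurable"
    by (intro lmeasurable_compact compact_convex_hull finite_imp_compact) simp
  then have "measure lebesgue (L ` (convex hull ?B)) = \<bar>det (matrix L)\<bar> * measure lebesgue (convex hull ?B)"
    by (rule measure_linear_image[OF lin])
  moreover have "measure lebesgue (convex hull ?B) = 1 / fact DIM(real^3)"
    unfolding content_std_simplex[symmetric]
    by (intro measure_completion)
      (simp, intro borel_compact compact_convex_hull finite_imp_compact, simp)
  moreover have "det (matrix L) = a \<bullet> cross3 b c"
    by (simp add: matrix_def L_def axis_def cross3_simps)
  moreover have "L ` (convex hull ?B) = convex hull {0, a, b, c}"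
    by (simp only: convex_hull_linear_image[OF lin] img)
  ultimately show ?thesis
    by (simp add: fact_numeral)
qed

text \<open>Translates a sum over tetrahedra containing \<open>x\<close> into a sum over crossings
  of the ray of multiples of \<open>x\<close> by factors at least 1.\<close>

lemma mem_cone_iff:
  assumes "x \<noteq> 0"
  shows "x \<in> convex hull (insert 0 (verts T)) \<longleftrightarrow> (\<exists>s\<ge>1. s *\<^sub>R x \<in> tri T)"
proof
  assume "x \<in> convex hull (insert 0 (verts T))"
  then obtain u v b where uvb: "u \<ge> 0" "v \<ge> 0" "u + v = 1" "b \<in> tri T" "x = u *\<^sub>R 0 + v *\<^sub>R b"
    using convex_hull_insert[of "verts T" 0] vert_in_verts[of T 1] unfolding tri_def by blast
  then have "v > 0" "v \<le> 1" using assms by (auto simp: order.order_iff_strict)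
  then show "\<exists>s\<ge>1. s *\<^sub>R x \<in> tri T"
    using uvb by (intro exI[of _ "1 / v"]) auto
next
  assume "\<exists>s\<ge>1. s *\<^sub>R x \<in> tri T"
  then obtain s where s: "s \<ge> 1" "s *\<^sub>R x \<in> tri T" by blast
  then have "s *\<^sub>R x \<in> convex hull (insert 0 (verts T))"
    unfolding tri_def using hull_mono[of "verts T" "insert 0 (verts T)" convex] by blast
  moreover have "0 \<in> convex hull (insert 0 (verts T))" by (rule hull_inc) simp
  ultimately have "(1 - 1 / s) *\<^sub>R 0 + (1 / s) *\<^sub>R (s *\<^sub>R x) \<in> convex hull (insert 0 (verts T))"
    using s by (intro convexD convex_convex_hull) auto
  then show "x \<in> convex hull (insert 0 (verts T))" using s by simp
qed

section \<open>The two sides of the surface\<close>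

lemma connected_subset_outside:
  assumes "connected K" "K \<inter> S = {}" "z \<in> K" "z \<in> outside S"
  shows "K \<subseteq> outside S"
proof
  fix y assume "y \<in> K"
  then have "connected_component (- S) z y"
    unfolding connected_component_def using assms by (intro exI[of _ K]) auto
  then show "y \<in> outside S" using assms(4) by (rule outside_same_component)
qed

lemma connected_subset_inside:
  assumes "connected K" "K \<inter> S = {}" "z \<in> K" "z \<in> inside S"
  shows "K \<subseteq> inside S"
proof
  fix y assume "y \<in> K"
  then have "connected_component (- S) z y"
    unfolding connected_component_def using assms by (intro exI[of _ K]) auto
  then show "y \<in> inside S" using assms(4) by (rule inside_same_component)
qed

text \<open>With a zero vector, the outer and the inner test point would coincide and lie both
  outside and inside.\<close>

lemma outward_ordered_orient_vec: "outward_ordered N \<Longrightarrow> orient_vec (N k) \<noteq> 0"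
proof
  assume N: "outward_ordered N" and 0: "orient_vec (N k) = 0"
  obtain x where "x \<in> rel_interior (tri (N k))"
    using rel_interior_eq_empty[OF convex_tri] tri_ne by blast
  then have "\<forall>\<^sub>F e in at_right (0::real). x \<in> outside (surface N) \<and> x \<in> inside (surface N)"
    using N[unfolded outward_ordered_def, rule_format, of x k] 0 by simp
  then show False
    using eventually_happens'[OF trivial_limit_at_right_real] inside_Int_outside by fastforce
qed

text \<open>The small half balls on both sides of an interior point of a triangle do not meet the
  surface, hence the sides prescribed in direction \<open>orient_vec\<close> are those of the whole half balls.\<close>

lemma half_balls:
  fixes N :: "'k::finite trisurf"
  assumes out: "outward_ordered N" and y: "y \<in> rel_interior (tri (N k))"
    and alone: "\<And>l. l \<noteq> k \<Longrightarrow> y \<notin> tri (N l)"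
  shows "\<exists>r>0. \<forall>z. dist y z < r \<longrightarrow>
    (orient_vec (N k) \<bullet> y < orient_vec (N k) \<bullet> z \<longrightarrow> z \<in> outside (surface N)) \<and>
    (orient_vec (N k) \<bullet> z < orient_vec (N k) \<bullet> y \<longrightarrow> z \<in> inside (surface N))"
proof -
  let ?J = "orient_vec (N k)" and ?S = "surface N"
  have J: "?J \<noteq> 0" using out by (rule outward_ordered_orient_vec)
  have yT: "y \<in> tri (N k)" using y rel_interior_subset by blast
  \<comment> \<open>The other triangles form a closed set missing \<open>y\<close>, so in a small
    ball the surface lies in one plane and each open half ball is a convex set off the
    surface.\<close>
  have "closed (\<Union>l\<in>UNIV - {k}. tri (N l))"
    by (intro closed_UN) (auto intro: compact_imp_closed compact_tri)
  then have "open (- (\<Union>l\<in>UNIV - {k}. tri (N l)))" by (rule open_Compl)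
  moreover have "y \<in> - (\<Union>l\<in>UNIV - {k}. tri (N l))" using alone by blast
  ultimately obtain r where r: "r > 0" "ball y r \<subseteq> - (\<Union>l\<in>UNIV - {k}. tri (N l))"
    by (meson open_contains_ball)
  have plane: "?J \<bullet> z = ?J \<bullet> y" if "z \<in> ball y r" "z \<in> ?S" for z
  proof -
    have "z \<in> tri (N k)" using that r(2) unfolding surface_def by blast
    then show ?thesis using yT by (simp add: orient_vec_inner_tri)
  qed
  \<comment> \<open>This bound keeps both normal test points in the ball; each of them then decides
    the side of its half ball.\<close>
  have "\<forall>\<^sub>F e in at_right (0::real). e < r / norm ?J"
    using r J by (intro eventually_at_right_less order_tendstoD(2)[OF tendsto_ident_at]) simp
  moreover have "\<forall>\<^sub>F e in at_right (0::real). 0 < e"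
    by (simp add: eventually_at_filter)
  ultimately have "\<forall>\<^sub>F e in at_right (0::real). 0 < e \<and> e < r / norm ?J \<and>
      y + e *\<^sub>R ?J \<in> outside ?S \<and> y - e *\<^sub>R ?J \<in> inside ?S"
    using out[unfolded outward_ordered_def, rule_format, OF y]
    by (auto intro: eventually_conj)
  then obtain e where e: "0 < e" "e < r / norm ?J" "y + e *\<^sub>R ?J \<in> outside ?S" "y - e *\<^sub>R ?J \<in> inside ?S"
    using eventually_happens'[OF trivial_limit_at_right_real] by blast
  have er: "e * norm ?J < r" using e J by (simp add: field_simps)
  have JJ: "?J \<bullet> ?J > 0" using J by simp
  let ?P = "ball y r \<inter> {z. ?J \<bullet> y < ?J \<bullet> z}" and ?M = "ball y r \<inter> {z. ?J \<bullet> z < ?J \<bullet> y}"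
  have "?P \<subseteq> outside ?S"
  proof (rule connected_subset_outside)
    show "connected ?P"
      using convex_halfspace_gt by (intro convex_connected convex_Int) auto
    show "?P \<inter> ?S = {}" using plane by fastforce
    show "y + e *\<^sub>R ?J \<in> ?P" using e er JJ by (simp add: dist_norm inner_add_right)
  qed (fact e)
  moreover have "?M \<subseteq> inside ?S"
  proof (rule connected_subset_inside)
    show "connected ?M"
      using convex_halfspace_lt by (intro convex_connected convex_Int) auto
    show "?M \<inter> ?S = {}" using plane by fastforce
    show "y - e *\<^sub>R ?J \<in> ?M" using e er JJ by (simp add: dist_norm inner_diff_right)
  qed (fact e)
  ultimately show ?thesis using r(1) by (intro exI[of _ r]) (auto simp: subset_iff)
qed

text \<open>The sign of every triangle met by the ray from \<open>x\<close> pointing away from the origin records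
  whether the ray leaves or enters the interior there.\<close>

lemma inside_eq_signed_cones:
  fixes N :: "'k::finite trisurf"
  assumes conf: "conforming N" and out: "outward_ordered N"
    and xS: "x \<notin> surface N" and xJ: "\<And>k. orient_vec (N k) \<bullet> x \<noteq> 0"
    and xE: "\<And>a b. a \<in> vertices N \<Longrightarrow> b \<in> vertices N \<Longrightarrow> x \<notin> span {a, b}"
  shows "(of_bool (x \<in> inside (surface N)) :: real) =
    (\<Sum>k\<in>UNIV. sgn (N k $ 1 \<bullet> cross3 (N k $ 2) (N k $ 3)) *
       of_bool (x \<in> convex hull (insert 0 (verts (N k)))))"
proof -
  let ?S = "surface N"
  define J where "J k = orient_vec (N k)" for k
  define d where "d k = N k $ 1 \<bullet> cross3 (N k $ 2) (N k $ 3)" for k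
  \<comment> \<open>The parameter at which the line through the origin and \<open>x\<close> meets
    the plane of the triangle, whether or not the triangle itself is hit there.\<close>
  define c where "c k = d k / (J k \<bullet> x)" for k
  define K where "K = {k. \<exists>s\<ge>1. s *\<^sub>R x \<in> tri (N k)}"
  have x0: "x \<noteq> 0" using xJ by auto
  have ceq: "s = c k" if "s *\<^sub>R x \<in> tri (N k)" for s k
    using orient_vec_inner_tri[OF that] xJ[of k] by (simp add: c_def d_def J_def field_simps)
  have cK: "c k \<ge> 1" "c k *\<^sub>R x \<in> tri (N k)" if "k \<in> K" for k
    using that ceq unfolding K_def by auto
  have off: "s *\<^sub>R x \<notin> span {a, b}" if "s \<ge> 1" "a \<in> vertices N" "b \<in> vertices N" for s a b
  proof
    assume "s *\<^sub>R x \<in> span {a, b}"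
    then have "(1 / s) *\<^sub>R (s *\<^sub>R x) \<in> span {a, b}" by (rule span_mul)
    then show False using xE \<open>s \<ge> 1\<close> \<open>a \<in> vertices N\<close> \<open>b \<in> vertices N\<close> by simp
  qed
  have vv: "a \<in> vertices N" if "a \<in> verts (N k)" for a k
    using that unfolding vertices_def by blast
  have alone: "k = l" if s: "s \<ge> 1" "s *\<^sub>R x \<in> tri (N k)" "s *\<^sub>R x \<in> tri (N l)" for s k l
  proof (rule ccontr)
    assume "k \<noteq> l"
    then obtain a b where ab: "a \<in> verts (N k)" "b \<in> verts (N k)" "s *\<^sub>R x \<in> convex hull {a, b}"
      using conforming_overlap_in_edge[OF conf _ s(2,3)] by blast
    then show False using convex_hull_subset_span[of "{a, b}"] off[OF s(1)] vv by blast
  qed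
  have inj: "inj_on c K"
  proof (rule inj_onI)
    fix k l assume kl: "k \<in> K" "l \<in> K" "c k = c l"
    show "k = l" using alone[OF cK(1)[OF kl(1)] cK(2)[OF kl(1)]] cK(2)[OF kl(2)] kl(3) by simp
  qed
  define C where "C = {s. s \<ge> 1 \<and> s *\<^sub>R x \<in> ?S}"
  have CK: "C = c ` K"
  proof
    show "C \<subseteq> c ` K"
    proof
      fix s assume "s \<in> C"
      then obtain k where "s \<ge> 1" "s *\<^sub>R x \<in> tri (N k)" unfolding C_def surface_def by auto
      then show "s \<in> c ` K" using ceq[of s k] unfolding K_def by auto
    qed
    show "c ` K \<subseteq> C" unfolding C_def surface_def using cK by auto
  qed
  \<comment> \<open>Since the crossing parameter is positive, the sign of the tetrahedron equals the
    sign of \<open>J k \<bullet> x\<close>, which tells whether the ray moves with or against the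
    outer normal.\<close>
  have dJ: "sgn (d k) = sgn (J k \<bullet> x)" if "k \<in> K" for k
  proof -
    have "d k = c k * (J k \<bullet> x)" using xJ[of k] by (simp add: c_def J_def)
    then show ?thesis using cK(1)[OF that] by (simp add: sgn_mult)
  qed
  \<comment> \<open>Crossings are counted by parameter, signs are attached to triangles; injectivity
    of \<open>c\<close> on \<open>K\<close> makes the passage well defined.\<close>
  define \<sigma> where "\<sigma> s = sgn (J (inv_into K c s) \<bullet> x)" for s
  define A where "A = {s. s *\<^sub>R x \<in> inside ?S}"
  have jump: "(\<sigma> s = 1 \<and> (\<forall>\<^sub>F s in at_left s. s \<in> A) \<and> (\<forall>\<^sub>F s in at_right s. s \<notin> A)) \<or>
      (\<sigma> s = -1 \<and> (\<forall>\<^sub>F s in at_left s. s \<notin> A) \<and> (\<forall>\<^sub>F s in at_right s. s \<in> A))"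
    if "s \<in> C" for s
  proof -
    obtain k where k: "k \<in> K" "s = c k" using \<open>s \<in> C\<close> CK by blast
    have s1: "s \<ge> 1" "s *\<^sub>R x \<in> tri (N k)" using cK[OF k(1)] k(2) by auto
    have \<sigma>: "\<sigma> s = sgn (J k \<bullet> x)" by (simp add: \<sigma>_def k inv_into_f_f[OF inj])
    have ri: "s *\<^sub>R x \<in> rel_interior (tri (N k))"
      using s1 off vv by (intro rel_interior_tri outward_ordered_orient_vec[OF out]) auto
    have only: "s *\<^sub>R x \<notin> tri (N l)" if "l \<noteq> k" for l
      using alone[OF s1] that by blast
    obtain r where "r > 0" and ball: "\<forall>z. dist (s *\<^sub>R x) z < r \<longrightarrow>
        (J k \<bullet> (s *\<^sub>R x) < J k \<bullet> z \<longrightarrow> z \<in> outside ?S) \<and>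
        (J k \<bullet> z < J k \<bullet> (s *\<^sub>R x) \<longrightarrow> z \<in> inside ?S)"
      using half_balls[OF out ri] only unfolding J_def by blast
    have near: "dist (s *\<^sub>R x) (s' *\<^sub>R x) < r" if "\<bar>s - s'\<bar> < r / norm x" for s'
    proof -
      have "dist (s *\<^sub>R x) (s' *\<^sub>R x) = \<bar>s - s'\<bar> * norm x"
        unfolding dist_norm by (metis norm_scaleR scaleR_left_diff_distrib)
      then show ?thesis using that x0 by (simp add: pos_less_divide_eq)
    qed
    have side: "s * (J k \<bullet> x) < s' * (J k \<bullet> x) \<Longrightarrow> s' *\<^sub>R x \<notin> inside ?S"
      "s' * (J k \<bullet> x) < s * (J k \<bullet> x) \<Longrightarrow> s' *\<^sub>R x \<in> inside ?S"
      if "\<bar>s - s'\<bar> < r / norm x" for s'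
      using ball[rule_format, OF near[OF that]] IntI[of _ "inside ?S" "outside ?S"] by auto
    have p: "r / norm x > 0" using \<open>r > 0\<close> x0 by simp
    have L: "\<forall>\<^sub>F s' in at_left s. s' < s \<and> \<bar>s - s'\<bar> < r / norm x"
      using p by (subst eventually_at_left[of "s - 1"]) (auto intro!: exI[of _ "s - r / norm x"])
    have R: "\<forall>\<^sub>F s' in at_right s. s < s' \<and> \<bar>s - s'\<bar> < r / norm x"
      using p by (subst eventually_at_right[of _ "s + 1"]) (auto intro!: exI[of _ "s + r / norm x"])
    consider "J k \<bullet> x > 0" | "J k \<bullet> x < 0" using xJ[of k] unfolding J_def by linarith
    then show ?thesis
    proof cases
      case 1
      have "\<forall>\<^sub>F s' in at_left s. s' \<in> A"
        using L unfolding A_def by (rule eventually_mono) (use side mult_strict_right_mono[OF _ 1] in auto)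
      moreover have "\<forall>\<^sub>F s' in at_right s. s' \<notin> A"
        using R unfolding A_def by (rule eventually_mono) (use side mult_strict_right_mono[OF _ 1] in auto)
      ultimately show ?thesis using 1 \<sigma> by simp
    next
      case 2
      have "\<forall>\<^sub>F s' in at_left s. s' \<notin> A"
        using L unfolding A_def by (rule eventually_mono) (use side mult_strict_right_mono_neg[OF _ 2] in auto)
      moreover have "\<forall>\<^sub>F s' in at_right s. s' \<in> A"
        using R unfolding A_def by (rule eventually_mono) (use side mult_strict_right_mono_neg[OF _ 2] in auto)
      ultimately show ?thesis using 2 \<sigma> by simp
    qed
  qed
  have const: "s \<in> A \<longleftrightarrow> t \<in> A" if "1 \<le> s" "s \<le> t" "{s..t} \<inter> C = {}" for s t
  proof -
    let ?L = "(\<lambda>u. u *\<^sub>R x) ` {s..t}"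
    have con: "connected ?L"
      by (intro connected_continuous_image continuous_intros) simp
    have dis: "?L \<inter> ?S = {}"
    proof (intro equals0I)
      fix z assume "z \<in> ?L \<inter> ?S"
      then obtain u where "u \<in> {s..t}" "u *\<^sub>R x \<in> ?S" by blast
      then have "u \<in> {s..t} \<inter> C" using that(1) by (simp add: C_def)
      then show False using that(3) by blast
    qed
    have mem: "s *\<^sub>R x \<in> ?L" "t *\<^sub>R x \<in> ?L" using that by auto
    show ?thesis
      using connected_subset_inside[OF con dis] mem unfolding A_def by blast
  qed
  have "bounded (inside ?S)" by (intro bounded_inside compact_imp_bounded compact_surface)
  then obtain B where B: "\<And>z. z \<in> inside ?S \<Longrightarrow> norm z \<le> B" by (auto simp: bounded_iff)
  have bdd: "s \<notin> A" if "s \<ge> (\<bar>B\<bar> + 1) / norm x" for s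
  proof
    assume "s \<in> A"
    then have "norm (s *\<^sub>R x) \<le> B" unfolding A_def by (intro B) simp
    moreover have "\<bar>B\<bar> + 1 \<le> s * norm x" using that x0 by (simp add: field_simps)
    moreover have "s * norm x \<le> \<bar>s\<bar> * norm x" by (intro mult_right_mono) auto
    ultimately show False by simp
  qed
  \<comment> \<open>The count starts at the point \<open>x\<close> itself, the parameter 1, which is
    not a crossing because \<open>x\<close> is off the surface.\<close>
  have C1: "1 \<notin> C" using xS by (simp add: C_def)
  have CC: "{s \<in> C. 1 < s} = C" using C1 by (auto simp: C_def order.order_iff_strict)
  have "(of_bool (1 \<in> A) :: real) = (\<Sum>s\<in>{s \<in> C. 1 < s}. \<sigma> s)"
    using crossing_sum[of C 1 A \<sigma> "(\<bar>B\<bar> + 1) / norm x" 1] CK const jump bdd C1 by simp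
  also have "\<dots> = (\<Sum>k\<in>K. \<sigma> (c k))" by (simp only: CC) (simp add: CK sum.reindex[OF inj])
  also have "\<dots> = (\<Sum>k\<in>K. sgn (d k))"
    by (intro sum.cong) (simp_all add: \<sigma>_def dJ inv_into_f_f[OF inj])
  also have "\<dots> = (\<Sum>k\<in>UNIV. sgn (d k) * of_bool (k \<in> K))"
    by (rule sum.mono_neutral_cong_left) auto
  finally show ?thesis
    by (simp add: A_def d_def K_def mem_cone_iff[OF x0])
qed

section \<open>Integration of the crossing identity\<close>

definition signed_volume :: "'k::finite trisurf \<Rightarrow> real" where
  "signed_volume N = (\<Sum>k\<in>UNIV. N k $ 1 \<bullet> cross3 (N k $ 2) (N k $ 3)) / 6"

text \<open>The crossing identity holds almost everywhere. Integrating it replaces each tetrahedron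
  by its measure, and the sign times the absolute value restores the signed volume.\<close>

theorem enclosed_volume_eq_signed_volume:
  fixes N :: "'k::finite trisurf"
  assumes conf: "conforming N" and out: "outward_ordered N"
  shows "enclosed_volume N = signed_volume N"
proof -
  let ?S = "surface N" and ?d = "\<lambda>k. N k $ 1 \<bullet> cross3 (N k $ 2) (N k $ 3)"
  let ?Q = "\<lambda>k. convex hull (insert 0 (verts (N k)))"
  \<comment> \<open>The families exclude, in turn, rays parallel to a triangle, points in the plane
    of a triangle (hence on the surface), and rays that may hit an edge.\<close>
  define Z where "Z = (\<Union>k. {x. orient_vec (N k) \<bullet> x = 0}) \<union> (\<Union>k. {x. orient_vec (N k) \<bullet> x = ?d k}) \<union>
    (\<Union>k. \<Union>i. \<Union>l. \<Union>j. span {N k $ i, N l $ j})"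
  have J: "orient_vec (N k) \<noteq> 0" for k using out by (rule outward_ordered_orient_vec)
  have "dim (span {a, b}) < DIM(real^3)" for a b :: "real^3"
    using dim_le_card[of "span {a, b}" "{a, b}"] card_insert_le_m1[of 2 "{b}" a] by simp
  then have E: "negligible (span {a, b})" for a b :: "real^3"
    by (rule negligible_lowdim)
  have P: "negligible {x. orient_vec (N k) \<bullet> x = c}" for k c
    using J by (simp add: negligible_hyperplane)
  have negZ: "negligible Z"
    unfolding Z_def by (intro negligible_Un negligible_Union) (auto intro!: negligible_Union P E)
  have ae: "indicator (inside ?S) x = (\<Sum>k\<in>UNIV. sgn (?d k) * indicator (?Q k) x)" if "x \<in> UNIV - Z" for x
  proof -
    have notin: "orient_vec (N k) \<bullet> x \<noteq> 0" "orient_vec (N k) \<bullet> x \<noteq> ?d k"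
      "x \<notin> span {N k $ i, N l $ j}" for k i l j
      using that unfolding Z_def by auto
    have "x \<notin> ?S"
      using notin(2) orient_vec_inner_tri unfolding surface_def by fast
    moreover have "x \<notin> span {a, b}" if "a \<in> vertices N" "b \<in> vertices N" for a b
      using that notin(3) unfolding vertices_iff by auto
    ultimately have "(of_bool (x \<in> inside ?S) :: real) = (\<Sum>k\<in>UNIV. sgn (?d k) * of_bool (x \<in> ?Q k))"
      using notin(1) by (intro inside_eq_signed_cones conf out)
    then show ?thesis by (simp add: indicator_def)
  qed
  have mQ: "measure lebesgue (?Q k) = \<bar>?d k\<bar> / 6" for k
    unfolding verts_def by (rule measure_tetrahedron)
  have "?Q k \<in> lmeasurable" for k
    unfolding verts_def by (intro lmeasurable_compact compact_convex_hull finite_imp_compact) simp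
  then have "(indicator (?Q k) has_integral \<bar>?d k\<bar> / 6) UNIV" for k
    unfolding lmeasurable_iff_has_integral mQ .
  then have "((\<lambda>x. \<Sum>k\<in>UNIV. sgn (?d k) * indicator (?Q k) x) has_integral
      (\<Sum>k\<in>UNIV. sgn (?d k) * (\<bar>?d k\<bar> / 6))) UNIV"
    by (intro has_integral_sum has_integral_mult_right) auto
  then have "(indicator (inside ?S) has_integral (\<Sum>k\<in>UNIV. sgn (?d k) * (\<bar>?d k\<bar> / 6))) UNIV"
    by (rule has_integral_spike[OF negZ ae, rotated -1])
  moreover have "inside ?S \<in> lmeasurable"
    by (intro lmeasurable_open open_inside bounded_inside compact_imp_closed compact_imp_bounded compact_surface)
  then have "(indicator (inside ?S) has_integral measure lebesgue (inside ?S)) UNIV"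
    by (simp add: lmeasurable_iff_has_integral)
  ultimately have "measure lebesgue (inside ?S) = (\<Sum>k\<in>UNIV. sgn (?d k) * (\<bar>?d k\<bar> / 6))"
    using has_integral_unique by blast
  also have "\<dots> = signed_volume N"
    by (simp add: signed_volume_def sum_divide_distrib sgn_mult_abs)
  finally show ?thesis by (simp add: enclosed_volume_def)
qed

section \<open>Finite element functions\<close>

text \<open>The two scalar coefficients are the barycentric coordinates of the second and third
  vertex, written through the basis dual to the edge vectors. The extension is constant in the
  normal direction.\<close>

definition affine_ext :: "triangle \<Rightarrow> (real^3 \<Rightarrow> 'b::real_vector) \<Rightarrow> real^3 \<Rightarrow> 'b" where
  "affine_ext T f x = f (T $ 1)
     + ((cross3 (T $ 3 - T $ 1) (orient_vec T) \<bullet> (x - T $ 1)) / (orient_vec T \<bullet> orient_vec T)) *\<^sub>R (f (T $ 2) - f (T $ 1))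
     + ((cross3 (orient_vec T) (T $ 2 - T $ 1) \<bullet> (x - T $ 1)) / (orient_vec T \<bullet> orient_vec T)) *\<^sub>R (f (T $ 3) - f (T $ 1))"

lemma affine_ext_barycentric:
  assumes J: "orient_vec T \<noteq> 0" and "u + v + w = 1"
  shows "affine_ext T f (u *\<^sub>R T $ 1 + v *\<^sub>R T $ 2 + w *\<^sub>R T $ 3) =
    u *\<^sub>R f (T $ 1) + v *\<^sub>R f (T $ 2) + w *\<^sub>R f (T $ 3)"
proof -
  define a b where "a = T $ 2 - T $ 1" and "b = T $ 3 - T $ 1"
  have u: "u = 1 - v - w" using assms by simp
  have x: "u *\<^sub>R T $ 1 + v *\<^sub>R T $ 2 + w *\<^sub>R T $ 3 - T $ 1 = v *\<^sub>R a + w *\<^sub>R b"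
    unfolding u a_def b_def by (simp add: algebra_simps)
  have J_ab: "orient_vec T = cross3 a b" by (simp add: orient_vec_def a_def b_def)
  have "cross3 b (orient_vec T) \<bullet> a = orient_vec T \<bullet> orient_vec T"
    "cross3 b (orient_vec T) \<bullet> b = 0" "cross3 (orient_vec T) a \<bullet> a = 0"
    "cross3 (orient_vec T) a \<bullet> b = orient_vec T \<bullet> orient_vec T"
    unfolding J_ab by (simp_all add: cross3_simps)
  then have "affine_ext T f (u *\<^sub>R T $ 1 + v *\<^sub>R T $ 2 + w *\<^sub>R T $ 3) =
      f (T $ 1) + v *\<^sub>R (f (T $ 2) - f (T $ 1)) + w *\<^sub>R (f (T $ 3) - f (T $ 1))"
    using J unfolding affine_ext_def x a_def[symmetric] b_def[symmetric] by (simp add: inner_add_right)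
  then show ?thesis unfolding u by (simp add: algebra_simps)
qed

lemma affine_ext_vert: "orient_vec T \<noteq> 0 \<Longrightarrow> affine_ext T f (T $ j) = f (T $ j)"
  using affine_ext_barycentric[of T 1 0 0 f] affine_ext_barycentric[of T 0 1 0 f]
    affine_ext_barycentric[of T 0 0 1 f] exhaust_3[of j] by auto

lemma affine_ext_linear:
  "\<exists>L c. linear L \<and> (\<forall>x. affine_ext T f x = c + L x)"
proof -
  define g where "g = (1 / (orient_vec T \<bullet> orient_vec T)) *\<^sub>R cross3 (T $ 3 - T $ 1) (orient_vec T)"
  define h where "h = (1 / (orient_vec T \<bullet> orient_vec T)) *\<^sub>R cross3 (orient_vec T) (T $ 2 - T $ 1)"
  define L where "L x = (g \<bullet> x) *\<^sub>R (f (T $ 2) - f (T $ 1)) + (h \<bullet> x) *\<^sub>R (f (T $ 3) - f (T $ 1))" for x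
  have "linear L"
    unfolding L_def by (intro linearI) (simp_all add: inner_add_right scaleR_add_left scaleR_add_right)
  moreover have "affine_ext T f x = (f (T $ 1) - L (T $ 1)) + L x" for x
    unfolding affine_ext_def L_def g_def h_def
    by (simp add: inner_diff_right diff_divide_distrib scaleR_diff_left)
  ultimately show ?thesis by blast
qed

lemma affine_ext_combine:
  assumes "s + t = 1"
  shows "affine_ext T f (s *\<^sub>R x + t *\<^sub>R y) = s *\<^sub>R affine_ext T f x + t *\<^sub>R affine_ext T f y"
proof -
  obtain L c where L: "linear L" "\<And>x. affine_ext T f x = c + L x"
    using affine_ext_linear[of T f] by blast
  have "c = s *\<^sub>R c + t *\<^sub>R c" using assms by (metis scaleR_add_left scaleR_one)
  then show ?thesis
    by (simp add: L(2) linear_add[OF L(1)] linear_scale[OF L(1)] scaleR_add_right)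
qed

text \<open>The definition of \<open>pw_linear\<close> only combines two points, so the first two
  vertices are merged into a point \<open>y\<close> of their edge, which is then combined with the
  third. The case \<open>w = 1\<close> avoids a zero divisor.\<close>

lemma pw_linear_barycentric:
  assumes f: "f \<in> pw_linear N" and uvw: "0 \<le> u" "0 \<le> v" "0 \<le> w" "u + v + w = 1"
  shows "f (u *\<^sub>R N k $ 1 + v *\<^sub>R N k $ 2 + w *\<^sub>R N k $ 3) =
    u *\<^sub>R f (N k $ 1) + v *\<^sub>R f (N k $ 2) + w *\<^sub>R f (N k $ 3)"
proof (cases "w = 1")
  case True
  then have "u = 0" "v = 0" using uvw by auto
  then show ?thesis using True by simp
next
  case False
  then have w: "1 - w > 0" using uvw by auto
  have lin: "f ((1 - s) *\<^sub>R x + s *\<^sub>R y) = (1 - s) *\<^sub>R f x + s *\<^sub>R f y"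
    if "x \<in> tri (N k)" "y \<in> tri (N k)" "0 \<le> s" "s \<le> 1" for x y s
    using f that unfolding pw_linear_def by simp
  define s where "s = v / (1 - w)"
  have s: "0 \<le> s" "s \<le> 1" "1 - s = u / (1 - w)" using uvw w by (auto simp: s_def field_simps)
  define y where "y = (1 - s) *\<^sub>R N k $ 1 + s *\<^sub>R N k $ 2"
  have y: "y \<in> tri (N k)" unfolding y_def using s by (intro convexD[OF convex_tri]) auto
  have e: "(1 - w) * (1 - s) = u" "(1 - w) * s = v" using w s(3) by (simp_all add: s_def)
  have "f ((1 - w) *\<^sub>R y + w *\<^sub>R N k $ 3) = (1 - w) *\<^sub>R f y + w *\<^sub>R f (N k $ 3)"
    using lin[OF y] uvw by simp
  moreover have "f y = (1 - s) *\<^sub>R f (N k $ 1) + s *\<^sub>R f (N k $ 2)"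
    unfolding y_def by (rule lin) (simp_all add: s(1,2))
  ultimately show ?thesis by (simp add: y_def scaleR_add_right e)
qed

lemma pw_linear_eq_affine_ext:
  assumes "f \<in> pw_linear N" "orient_vec (N k) \<noteq> 0" "x \<in> tri (N k)"
  shows "f x = affine_ext (N k) f x"
proof -
  obtain u v w where uvw: "0 \<le> u" "0 \<le> v" "0 \<le> w" "u + v + w = 1"
    "x = u *\<^sub>R N k $ 1 + v *\<^sub>R N k $ 2 + w *\<^sub>R N k $ 3"
    using assms(3) tri_iff by blast
  then show ?thesis
    by (simp only: pw_linear_barycentric[OF assms(1) uvw(1-4)] affine_ext_barycentric[OF assms(2) uvw(4)])
qed

lemma pw_linear_const_on_tri:
  assumes f: "f \<in> pw_linear N" and c: "\<And>j. f (N k $ j) = c" and x: "x \<in> tri (N k)"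
  shows "f x = c"
proof -
  obtain u v w where uvw: "0 \<le> u" "0 \<le> v" "0 \<le> w" "u + v + w = 1"
    "x = u *\<^sub>R N k $ 1 + v *\<^sub>R N k $ 2 + w *\<^sub>R N k $ 3"
    using x tri_iff by blast
  have "f x = (u + v + w) *\<^sub>R c"
    unfolding uvw(5) pw_linear_barycentric[OF f uvw(1-4)] c by (simp add: scaleR_add_left)
  then show ?thesis by (simp add: uvw(4))
qed

lemma pw_linear_const: "(\<lambda>_. c) \<in> pw_linear N"
  unfolding pw_linear_def by (auto simp flip: scaleR_add_left)

lemma pw_linear_interpolant:
  fixes N :: "'k::finite trisurf" and f :: "real^3 \<Rightarrow> 'b::real_normed_vector"
  assumes N: "conforming N"
  shows "\<exists>g\<in>pw_linear N. \<forall>p\<in>vertices N. g p = f p"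
proof -
  \<comment> \<open>The triangle is chosen arbitrarily. The choice is harmless: two affine
    extensions agree at common vertices, hence on their convex hull, which is the whole
    intersection.\<close>
  define g where "g x = affine_ext (N (SOME k. x \<in> tri (N k))) f x" for x
  have agree: "affine_ext (N k) f x = affine_ext (N l) f x" if "x \<in> tri (N k)" "x \<in> tri (N l)" for k l x
  proof -
    let ?A = "{x. affine_ext (N k) f x = affine_ext (N l) f x}"
    have "convex ?A" by (rule convexI) (simp add: affine_ext_combine)
    moreover have "verts (N k) \<inter> verts (N l) \<subseteq> ?A"
    proof
      fix p assume "p \<in> verts (N k) \<inter> verts (N l)"
      then obtain i j where ij: "p = N k $ i" "p = N l $ j" unfolding verts_eq by blast
      have "affine_ext (N k) f p = f p" "affine_ext (N l) f p = f p"
        using affine_ext_vert[OF conforming_orient_vec[OF N], of k f i]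
          affine_ext_vert[OF conforming_orient_vec[OF N], of l f j] ij by simp_all
      then show "p \<in> ?A" by simp
    qed
    ultimately have "convex hull (verts (N k) \<inter> verts (N l)) \<subseteq> ?A" by (rule hull_minimal[rotated])
    then show ?thesis using conforming_Int[OF N, of k l] that by blast
  qed
  have g: "g x = affine_ext (N k) f x" if "x \<in> tri (N k)" for k x
    unfolding g_def using that by (intro agree someI[of "\<lambda>k. x \<in> tri (N k)" k])
  have "continuous_on (tri (N k)) g" for k
  proof -
    obtain L c where L: "linear L" "\<And>x. affine_ext (N k) f x = c + L x"
      using affine_ext_linear[of "N k" f] by blast
    have "continuous_on (tri (N k)) (\<lambda>x. c + L x)"
      using linear_continuous_on L(1) linear_conv_bounded_linear by (intro continuous_intros) blast
    then show ?thesis using g L(2) by (simp cong: continuous_on_cong)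
  qed
  then have "continuous_on (surface N) g"
    unfolding surface_def
    by (intro continuous_on_closed_Union) (auto intro: compact_imp_closed compact_tri)
  moreover have "g ((1 - s) *\<^sub>R x + s *\<^sub>R y) = (1 - s) *\<^sub>R g x + s *\<^sub>R g y"
    if "x \<in> tri (N k)" "y \<in> tri (N k)" "s \<in> {0..1}" for k x y s
  proof -
    have "(1 - s) *\<^sub>R x + s *\<^sub>R y \<in> tri (N k)"
      using that by (intro convexD[OF convex_tri]) auto
    then show ?thesis using that by (simp add: g affine_ext_combine)
  qed
  ultimately have "g \<in> pw_linear N" by (simp add: pw_linear_def)
  moreover have "g p = f p" if pN: "p \<in> vertices N" for p
  proof -
    obtain k j where p: "p = N k $ j" using pN by (auto simp: vertices_iff)
    have "g p = affine_ext (N k) f p" unfolding p by (rule g) simp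
    then show ?thesis unfolding p by (simp only: affine_ext_vert[OF conforming_orient_vec[OF N]])
  qed
  ultimately show ?thesis by blast
qed

text \<open>\<open>interp\<close> is a choice, so a witness has to be exhibited; here the constant
  function is one.\<close>

lemma interp_const:
  assumes "\<And>p. p \<in> vertices N \<Longrightarrow> f p = c"
  shows "interp N f \<in> pw_linear N" "p \<in> vertices N \<Longrightarrow> interp N f p = c"
proof -
  have "\<exists>g. g \<in> pw_linear N \<and> (\<forall>p\<in>vertices N. g p = f p)"
    using pw_linear_const[of c N] assms by (intro exI[of _ "\<lambda>_. c"]) simp
  then have *: "interp N f \<in> pw_linear N \<and> (\<forall>p\<in>vertices N. interp N f p = f p)"
    unfolding interp_def by (rule someI_ex)
  then show "interp N f \<in> pw_linear N" by blast
  show "p \<in> vertices N \<Longrightarrow> interp N f p = c" using * assms by simp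
qed

section \<open>Images under piecewise linear parameterizations\<close>

lemma image_surf_nth [simp]: "image_surf X M k $ j = X (M k $ j)"
  by (simp add: image_surf_def)

lemma verts_image_surf: "verts (image_surf X M k) = X ` verts (M k)"
  by (auto simp: verts_eq)

lemma image_convex_hull_verts:
  assumes "X \<in> pw_linear M" "orient_vec (M k) \<noteq> 0" "V \<subseteq> verts (M k)"
  shows "X ` (convex hull V) = convex hull (X ` V)"
proof -
  obtain L c where L: "linear L" "\<And>x. affine_ext (M k) X x = c + L x"
    using affine_ext_linear[of "M k" X] by blast
  have "convex hull V \<subseteq> tri (M k)" unfolding tri_def by (rule hull_mono[OF assms(3)])
  then have eq: "X x = c + L x" if "x \<in> convex hull V" for x
    using pw_linear_eq_affine_ext[OF assms(1,2)] L(2) that by auto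
  have "X ` (convex hull V) = (+) c ` L ` (convex hull V)"
    unfolding image_image by (rule image_cong[OF refl eq])
  also have "\<dots> = convex hull ((+) c ` L ` V)"
    by (simp only: convex_hull_translation convex_hull_linear_image[OF L(1)])
  also have "(+) c ` L ` V = X ` V"
    unfolding image_image by (rule image_cong[OF refl, symmetric]) (simp add: eq hull_inc)
  finally show ?thesis .
qed

text \<open>An injective map commutes with intersections, and a map affine on each triangle commutes
  with convex hulls of its vertices. Non-degeneracy comes from the outward orientation.\<close>

lemma conforming_image_surf:
  fixes M :: "'k::finite trisurf"
  assumes M: "conforming M" and X: "parameterizes M X"
  shows "conforming (image_surf X M)"
proof -
  let ?N = "image_surf X M"
  have pw: "X \<in> pw_linear M" and inj: "inj_on X (surface M)" and out: "outward_ordered ?N"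
    using X unfolding parameterizes_def by blast+
  have img: "tri (?N k) = X ` tri (M k)" for k
    unfolding tri_def verts_image_surf
    using image_convex_hull_verts[OF pw conforming_orient_vec[OF M] order_refl] by simp
  have sub: "tri (M k) \<subseteq> surface M" "verts (M k) \<subseteq> surface M" for k
    by (rule tri_subset_surface) (auto simp: verts_eq)
  have "tri (?N k) \<inter> tri (?N l) = convex hull (verts (?N k) \<inter> verts (?N l))" for k l
  proof -
    have "tri (?N k) \<inter> tri (?N l) = X ` (tri (M k) \<inter> tri (M l))"
      unfolding img by (rule inj_on_image_Int[OF inj sub(1) sub(1), symmetric])
    also have "\<dots> = X ` (convex hull (verts (M k) \<inter> verts (M l)))"
      by (simp add: conforming_Int[OF M])
    also have "\<dots> = convex hull (X ` (verts (M k) \<inter> verts (M l)))"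
      by (rule image_convex_hull_verts[OF pw conforming_orient_vec[OF M]]) blast
    also have "X ` (verts (M k) \<inter> verts (M l)) = verts (?N k) \<inter> verts (?N l)"
      unfolding verts_image_surf by (rule inj_on_image_Int[OF inj sub(2) sub(2)])
    finally show ?thesis .
  qed
  moreover have "verts (?N k) \<noteq> verts (?N l)" if "k \<noteq> l" for k l
    unfolding verts_image_surf inj_on_image_eq_iff[OF inj sub(2) sub(2)]
    using M that by (simp add: conforming_def)
  ultimately show ?thesis
    unfolding conforming_def using outward_ordered_orient_vec[OF out] by blast
qed

section \<open>Gradients and integrals on a flat triangle\<close>

text \<open>As the gradient is a definite description, uniqueness must be shown. The derivative
  within the triangle fixes \<open>g\<close> only along the triangle; orthogonality to the normal
  fixes the rest.\<close>

lemma tri_grad_const: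
  assumes J: "orient_vec T \<noteq> 0" and x: "x \<in> tri T" and f: "\<And>y. y \<in> tri T \<Longrightarrow> f y = c"
  shows "tri_grad T f x = 0"
  unfolding tri_grad_def
proof (rule the_equality)
  have "((\<lambda>_. c) has_derivative (\<lambda>_. 0)) (at x within tri T)" by (rule has_derivative_const)
  then have "(f has_derivative (\<lambda>_. 0)) (at x within tri T)"
    by (rule has_derivative_transform[OF x f, rotated])
  then show "0 \<bullet> orient_vec T = 0 \<and> (f has_derivative (\<lambda>h. 0 \<bullet> h)) (at x within tri T)"
    by simp
next
  fix g assume g: "g \<bullet> orient_vec T = 0 \<and> (f has_derivative (\<lambda>h. g \<bullet> h)) (at x within tri T)"
  have dir: "g \<bullet> (y - x) = 0" if y: "y \<in> tri T" for y
  proof (rule ccontr)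
    assume ne: "g \<bullet> (y - x) \<noteq> 0"
    then have n: "norm (y - x) > 0" by auto
    \<comment> \<open>Half of the supposed slope: an error bound with this \<open>e\<close> forces
      the slope below its own half.\<close>
    define e where "e = \<bar>g \<bullet> (y - x)\<bar> / (2 * norm (y - x))"
    have "e > 0" using ne n by (simp add: e_def)
    then obtain d where d: "d > 0" "\<And>z. z \<in> tri T \<Longrightarrow> norm (z - x) < d \<Longrightarrow>
        norm (f z - f x - g \<bullet> (z - x)) \<le> e * norm (z - x)"
      using g unfolding has_derivative_within_alt by blast
    define s where "s = min 1 (d / (2 * norm (y - x)))"
    have s: "0 < s" "s \<le> 1" using d n by (auto simp: s_def)
    have sd: "s * norm (y - x) < d"
    proof -
      have "s * norm (y - x) \<le> d / (2 * norm (y - x)) * norm (y - x)"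
        using n by (intro mult_right_mono) (auto simp: s_def)
      also have "\<dots> = d / 2" using n by simp
      finally show ?thesis using d by simp
    qed
    define z where "z = x + s *\<^sub>R (y - x)"
    have "z = (1 - s) *\<^sub>R x + s *\<^sub>R y" by (simp add: z_def algebra_simps)
    then have z: "z \<in> tri T" using s by (simp add: convexD[OF convex_tri x y])
    have "norm (f z - f x - g \<bullet> (z - x)) \<le> e * norm (z - x)"
      using z sd s by (intro d(2)) (auto simp: z_def)
    moreover have "z - x = s *\<^sub>R (y - x)" by (simp add: z_def)
    ultimately have "s * \<bar>g \<bullet> (y - x)\<bar> \<le> s * (e * norm (y - x))"
      using s f[OF z] f[OF x] by (simp add: abs_mult mult.left_commute)
    then have "\<bar>g \<bullet> (y - x)\<bar> \<le> e * norm (y - x)" using s by simp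
    also have "\<dots> = \<bar>g \<bullet> (y - x)\<bar> / 2" using n by (simp add: e_def)
    finally show False using ne by simp
  qed
  have "g \<bullet> (T $ i - T $ j) = 0" for i j
    using dir[of "T $ i"] dir[of "T $ j"] by (simp add: inner_diff_right)
  then have "g \<bullet> (T $ 2 - T $ 1) = 0" "g \<bullet> (T $ 3 - T $ 1) = 0" by blast+
  \<comment> \<open>Being orthogonal to both edges makes \<open>g\<close> parallel to the normal,
    while it is also orthogonal to the normal.\<close>
  then have "cross3 g (orient_vec T) = 0"
    unfolding orient_vec_def Lagrange by simp
  then show "g = 0"
    using norm_cross_dot[of g "orient_vec T"] g J by simp
qed

lemma reference_triangle_integral:
  fixes a b c :: real
  shows "integral {(s::real, t::real). 0 \<le> s \<and> 0 \<le> t \<and> s + t \<le> 1} (\<lambda>(s, t). c + s * a + t * b)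
    = c / 2 + a / 6 + b / 6"
proof -
  let ?R = "{(s::real, t::real). 0 \<le> s \<and> 0 \<le> t \<and> s + t \<le> 1}"
  define f where "f = (\<lambda>(s::real, t::real). c + s * a + t * b)"
  have "closed ?R"
    unfolding split_def by (intro closed_Collect_conj closed_Collect_le continuous_intros)
  moreover have "bounded ?R"
    by (rule bounded_subset[OF bounded_cbox[of "(0, 0)" "(1, 1)"]]) (auto simp: mem_box)
  ultimately have R: "compact ?R" by (simp add: compact_eq_bounded_closed)
  have cont: "continuous_on ?R f" unfolding f_def split_def by (intro continuous_intros)
  have int: "integrable lborel (\<lambda>x. indicator ?R x *\<^sub>R f x)"
    by (rule borel_integrable_compact[OF R cont])
  then have "set_integrable lborel ?R f" by (simp add: set_integrable_def)
  then have "integral ?R f = (\<integral>x. indicator ?R x *\<^sub>R f x \<partial>lborel)"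
    by (simp add: set_borel_integral_eq_integral(2)[symmetric] set_lebesgue_integral_def)
  also have "\<dots> = (\<integral>s. \<integral>t. indicator ?R (s, t) *\<^sub>R f (s, t) \<partial>lborel \<partial>lborel)"
    using lborel_pair.integral_fst'[of "\<lambda>x. indicator ?R x *\<^sub>R f x"] int by (simp add: lborel_prod)
  also have "\<dots> = (\<integral>s. ((c + s * a) * (1 - s) + b * (1 - s)^2 / 2) * indicator {0..1} s \<partial>lborel)"
  proof (rule Bochner_Integration.integral_cong[OF refl])
    fix s :: real
    show "(\<integral>t. indicator ?R (s, t) *\<^sub>R f (s, t) \<partial>lborel) =
        ((c + s * a) * (1 - s) + b * (1 - s)^2 / 2) * indicator {0..1} s"
    proof (cases "s \<in> {0..1}")
      case True
      have "(\<integral>t. indicator ?R (s, t) *\<^sub>R f (s, t) \<partial>lborel) =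
          (\<integral>t. (c + s * a + t * b) * indicator {0..1 - s} t \<partial>lborel)"
        using True by (intro Bochner_Integration.integral_cong refl) (auto simp: indicator_def f_def)
      also have "\<dots> = ((c + s * a) * (1 - s) + b * (1 - s)^2 / 2) - ((c + s * a) * 0 + b * 0^2 / 2)"
        using True by (intro integral_FTC_Icc_real) (auto intro!: derivative_eq_intros continuous_intros)
      finally show ?thesis using True by simp
    next
      case False
      then have "indicator ?R (s, t) = (0::real)" for t by (auto simp: indicator_def)
      then show ?thesis using False by simp
    qed
  qed
  also have "\<dots> = c / 2 + a / 6 + b / 6"
  proof -
    \<comment> \<open>An antiderivative of the inner integral as a polynomial in \<open>s\<close>,
      with one summand for each of \<open>c\<close>, \<open>a\<close> and \<open>b\<close>.\<close>
    let ?F = "\<lambda>s. c * (s - s^2 / 2) + a * (s^2 / 2 - s^3 / 3) - b * (1 - s)^3 / 6"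
    have "(\<integral>s. ((c + s * a) * (1 - s) + b * (1 - s)^2 / 2) * indicator {0..1} s \<partial>lborel) = ?F 1 - ?F 0"
    proof (rule integral_FTC_Icc_real)
      fix s :: real
      show "(?F has_real_derivative (c + s * a) * (1 - s) + b * (1 - s)^2 / 2) (at s)"
        by (auto intro!: derivative_eq_intros simp: field_simps power2_eq_square)
    qed (auto intro!: continuous_intros)
    then show ?thesis by simp
  qed
  finally show ?thesis by (simp add: f_def)
qed

lemma tri_point_in_tri:
  assumes "0 \<le> s" "0 \<le> t" "s + t \<le> 1"
  shows "T $ 1 + s *\<^sub>R (T $ 2 - T $ 1) + t *\<^sub>R (T $ 3 - T $ 1) \<in> tri T"
  unfolding tri_iff using assms
  by (intro exI[of _ "1 - s - t"] exI[of _ s] exI[of _ t]) (simp add: algebra_simps)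

lemma tri_integral_cong:
  assumes "\<And>x. x \<in> tri T \<Longrightarrow> f x = g x"
  shows "tri_integral T f = tri_integral T g"
  unfolding tri_integral_def
  by (intro arg_cong[of _ _ "(*) (norm (orient_vec T))"] Henstock_Kurzweil_Integration.integral_cong)
     (auto intro!: assms tri_point_in_tri)

lemma tri_integral_0: "(\<And>x. x \<in> tri T \<Longrightarrow> f x = 0) \<Longrightarrow> tri_integral T f = 0"
  using tri_integral_cong[of T f "\<lambda>_. 0"] by (simp add: tri_integral_def split_def)

lemma tri_integral_nonneg:
  assumes "\<And>x. f x \<ge> 0"
  shows "tri_integral T f \<ge> 0"
  unfolding tri_integral_def split_def
  by (intro mult_nonneg_nonneg norm_ge_zero)
     \<comment> \<open>A non-integrable function has integral 0 by convention, which settles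
       integrands of unknown regularity.\<close>
     (metis (no_types, lifting) integral_nonneg not_integrable_integral order_refl assms)

lemma L2_prod_self_nonneg: "L2_prod N f f \<ge> 0"
  unfolding L2_prod_def by (intro sum_nonneg tri_integral_nonneg) simp

text \<open>The vertex rule is exact for affine integrands. Hence lumped and exact products agree
  when one factor is constant on each triangle and the other piecewise linear.\<close>

lemma tri_integral_affine:
  assumes "\<And>u v w. 0 \<le> u \<Longrightarrow> 0 \<le> v \<Longrightarrow> 0 \<le> w \<Longrightarrow> u + v + w = 1 \<Longrightarrow>
    f (u *\<^sub>R T $ 1 + v *\<^sub>R T $ 2 + w *\<^sub>R T $ 3) = u * f (T $ 1) + v * f (T $ 2) + w * f (T $ 3)"
  shows "tri_integral T f = tri_area T / 3 * (\<Sum>j\<in>UNIV. f (T $ j))"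
proof -
  let ?R = "{(s::real, t::real). 0 \<le> s \<and> 0 \<le> t \<and> s + t \<le> 1}"
  have "integral ?R (\<lambda>(s, t). f (T $ 1 + s *\<^sub>R (T $ 2 - T $ 1) + t *\<^sub>R (T $ 3 - T $ 1))) =
      integral ?R (\<lambda>(s, t). f (T $ 1) + s * (f (T $ 2) - f (T $ 1)) + t * (f (T $ 3) - f (T $ 1)))"
  proof (rule Henstock_Kurzweil_Integration.integral_cong)
    fix p assume "p \<in> ?R"
    then obtain s t where st: "p = (s, t)" "0 \<le> s" "0 \<le> t" "s + t \<le> 1" by auto
    have "T $ 1 + s *\<^sub>R (T $ 2 - T $ 1) + t *\<^sub>R (T $ 3 - T $ 1) =
        (1 - s - t) *\<^sub>R T $ 1 + s *\<^sub>R T $ 2 + t *\<^sub>R T $ 3" by (simp add: algebra_simps)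
    also have "f \<dots> = (1 - s - t) * f (T $ 1) + s * f (T $ 2) + t * f (T $ 3)"
      using st by (intro assms) auto
    finally show "(case p of (s, t) \<Rightarrow> f (T $ 1 + s *\<^sub>R (T $ 2 - T $ 1) + t *\<^sub>R (T $ 3 - T $ 1))) =
        (case p of (s, t) \<Rightarrow> f (T $ 1) + s * (f (T $ 2) - f (T $ 1)) + t * (f (T $ 3) - f (T $ 1)))"
      by (simp add: st(1) algebra_simps)
  qed
  also have "\<dots> = (f (T $ 1) + f (T $ 2) + f (T $ 3)) / 6"
    by (simp only: reference_triangle_integral) (simp add: field_simps)
  finally show ?thesis
    unfolding tri_integral_def tri_area_def sum_3 by simp
qed

section \<open>The lumped projection\<close>

text \<open>Mass lumping makes the system diagonal, so the solution is explicit: at a vertex, the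
  area-weighted mean of \<open>w\<close> over the adjacent triangles. Only nodal values of
  \<open>\<xi>\<close> enter, so \<open>\<xi>\<close> may be any function.\<close>

lemma lumped_proj_pw_linear_exists:
  fixes N :: "'k::finite trisurf"
  assumes N: "conforming N"
  shows "\<exists>p\<in>pw_linear N. \<forall>\<xi>. lumped_prod N p \<xi> =
    1/3 * (\<Sum>k\<in>UNIV. tri_area (N k) * (\<Sum>j\<in>UNIV. w k \<bullet> \<xi> (N k $ j)))"
proof -
  define v where "v = (\<lambda>(k, j). N k $ j)"
  define a where "a i = tri_area (N (fst i))" for i :: "'k \<times> 3"
  \<comment> \<open>The corners, as pairs of triangle and index, located at the point
    \<open>p\<close>; regrouping the sum by these sets decouples the vertices.\<close>
  define star where "star p = {i. v i = p}" for p
  define q where "q p = (1 / sum a (star p)) *\<^sub>R (\<Sum>i\<in>star p. a i *\<^sub>R w (fst i))" for p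
  have a: "a i > 0" for i
    using conforming_orient_vec[OF N] by (simp add: a_def tri_area_def)
  obtain p where p: "p \<in> pw_linear N" "\<And>x. x \<in> vertices N \<Longrightarrow> p x = q x"
    using pw_linear_interpolant[OF N, of q] by blast
  have "lumped_prod N p \<xi> = 1/3 * (\<Sum>k\<in>UNIV. tri_area (N k) * (\<Sum>j\<in>UNIV. w k \<bullet> \<xi> (N k $ j)))" for \<xi>
  proof -
    have star: "(\<Sum>i\<in>star x. a i * (q x \<bullet> \<xi> x)) = (\<Sum>i\<in>star x. a i * (w (fst i) \<bullet> \<xi> x))"
      if "x \<in> range v" for x
    proof -
      have "star x \<noteq> {}" using that by (auto simp: star_def)
      then have "sum a (star x) > 0" by (intro sum_pos a) auto
      then have "sum a (star x) *\<^sub>R q x = (\<Sum>i\<in>star x. a i *\<^sub>R w (fst i))" by (simp add: q_def)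
      then have "(sum a (star x) *\<^sub>R q x) \<bullet> \<xi> x = (\<Sum>i\<in>star x. a i *\<^sub>R w (fst i)) \<bullet> \<xi> x" by simp
      then show ?thesis by (simp add: inner_sum_left sum_distrib_right)
    qed
    have reg: "(\<Sum>i\<in>UNIV. f i) = (\<Sum>x\<in>range v. \<Sum>i\<in>star x. f i)" for f :: "'k \<times> 3 \<Rightarrow> real"
      using sum.image_gen[of UNIV f v] by (simp add: star_def)
    have "(\<Sum>k\<in>UNIV. tri_area (N k) * (\<Sum>j\<in>UNIV. p (N k $ j) \<bullet> \<xi> (N k $ j))) =
        (\<Sum>i\<in>UNIV. a i * (q (v i) \<bullet> \<xi> (v i)))"
      by (simp add: sum_distrib_left sum.cartesian_product a_def v_def split_def p(2))
    also have "\<dots> = (\<Sum>x\<in>range v. \<Sum>i\<in>star x. a i * (q x \<bullet> \<xi> x))"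
      unfolding reg by (intro sum.cong refl) (simp add: star_def)
    also have "\<dots> = (\<Sum>x\<in>range v. \<Sum>i\<in>star x. a i * (w (fst i) \<bullet> \<xi> x))"
      by (intro sum.cong refl star)
    also have "\<dots> = (\<Sum>i\<in>UNIV. a i * (w (fst i) \<bullet> \<xi> (v i)))"
      unfolding reg by (intro sum.cong refl) (simp add: star_def)
    also have "\<dots> = (\<Sum>k\<in>UNIV. tri_area (N k) * (\<Sum>j\<in>UNIV. w k \<bullet> \<xi> (N k $ j)))"
      by (simp add: sum_distrib_left sum.cartesian_product a_def v_def split_def)
    finally show ?thesis by (simp add: lumped_prod_def)
  qed
  then show ?thesis using p(1) by blast
qed

lemma L2_prod_const_pw_linear:
  assumes \<xi>: "\<xi> \<in> pw_linear N"
  shows "L2_prod N (\<lambda>k x. w k) (\<lambda>k. \<xi>) =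
    1/3 * (\<Sum>k\<in>UNIV. tri_area (N k) * (\<Sum>j\<in>UNIV. w k \<bullet> \<xi> (N k $ j)))"
proof -
  have aff: "tri_integral (N k) (\<lambda>x. w k \<bullet> \<xi> x) = tri_area (N k) / 3 * (\<Sum>j\<in>UNIV. w k \<bullet> \<xi> (N k $ j))" for k
    by (rule tri_integral_affine) (simp only: pw_linear_barycentric[OF \<xi>] inner_add_right inner_scaleR_right)
  show ?thesis
    unfolding L2_prod_def aff sum_distrib_left[of "1/3"] by (intro sum.cong refl) simp
qed

text \<open>An arbitrary \<open>d\<close> may be replaced by its interpolant, so the second fact
  applies directly to the displacement of a time step.\<close>

lemma lumped_proj:
  fixes N :: "'k::finite trisurf"
  assumes N: "conforming N"
  shows "lumped_proj N w \<in> pw_linear N"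
    and "lumped_prod N (lumped_proj N w) d =
      1/3 * (\<Sum>k\<in>UNIV. tri_area (N k) * (\<Sum>j\<in>UNIV. w k \<bullet> d (N k $ j)))"
proof -
  obtain p where "p \<in> pw_linear N"
    "\<forall>\<xi>. lumped_prod N p \<xi> = 1/3 * (\<Sum>k\<in>UNIV. tri_area (N k) * (\<Sum>j\<in>UNIV. w k \<bullet> \<xi> (N k $ j)))"
    using lumped_proj_pw_linear_exists[OF N, of w] by (elim bexE) (rule that)
  then have "\<exists>p. p \<in> pw_linear N \<and>
      (\<forall>\<xi>\<in>pw_linear N. lumped_prod N p \<xi> = L2_prod N (\<lambda>k x. w k) (\<lambda>k. \<xi>))"
    by (intro exI[of _ p]) (simp add: L2_prod_const_pw_linear)
  then have *: "lumped_proj N w \<in> pw_linear N \<and>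
      (\<forall>\<xi>\<in>pw_linear N. lumped_prod N (lumped_proj N w) \<xi> = L2_prod N (\<lambda>k x. w k) (\<lambda>k. \<xi>))"
    unfolding lumped_proj_def by (rule someI_ex)
  then show "lumped_proj N w \<in> pw_linear N" by blast
  obtain \<xi> where \<xi>: "\<xi> \<in> pw_linear N" "\<And>p. p \<in> vertices N \<Longrightarrow> \<xi> p = d p"
    using pw_linear_interpolant[OF N, of d] by blast
  have "lumped_prod N (lumped_proj N w) d = lumped_prod N (lumped_proj N w) \<xi>"
    by (simp add: lumped_prod_def \<xi>(2))
  also have "\<dots> = L2_prod N (\<lambda>k x. w k) (\<lambda>k. \<xi>)" using * \<xi>(1) by blast
  finally show "lumped_prod N (lumped_proj N w) d =
      1/3 * (\<Sum>k\<in>UNIV. tri_area (N k) * (\<Sum>j\<in>UNIV. w k \<bullet> d (N k $ j)))"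
    by (simp add: L2_prod_const_pw_linear[OF \<xi>(1)] \<xi>(2))
qed

section \<open>The increment of the signed volume\<close>

text \<open>The set of directed edges is invariant under reversal, and each occurs in one place
  only. Reversal therefore maps the sum to its own negative.\<close>

lemma sum_edges_eq_0:
  fixes g :: "real^3 \<Rightarrow> real^3 \<Rightarrow> real"
  assumes M: "closed_polyhedral M" and anti: "\<And>a b. g b a = - g a b"
  shows "(\<Sum>k\<in>UNIV. \<Sum>j\<in>UNIV. g (M k $ j) (M k $ (j + 1))) = 0"
proof -
  define e where "e = (\<lambda>(k, j). (M k $ j, M k $ (j + 1)))"
  have opp: "\<exists>!l. directed_edge (M l) b a" if "directed_edge (M k) a b" for k a b
    using M that unfolding closed_polyhedral_def by simp
  have de: "directed_edge (M k) (M k $ j) (M k $ (j + 1))" for k j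
    unfolding directed_edge_def by blast
  have inj: "inj e"
  proof (rule injI)
    fix x y assume "e x = e y"
    moreover obtain k i l j where xy: "x = (k, i)" "y = (l, j)" by (cases x, cases y)
    ultimately have eq: "M k $ i = M l $ j" "M k $ (i + 1) = M l $ (j + 1)" by (auto simp: e_def)
    \<comment> \<open>The detour through the neighbour \<open>m\<close>: both \<open>k\<close> and
      \<open>l\<close> contain the reverse of an edge of \<open>m\<close>, and that triangle is
      unique.\<close>
    obtain m where m: "directed_edge (M m) (M k $ (i + 1)) (M k $ i)" using opp[OF de] by blast
    have "k = l" using opp[OF m] de[of k i] de[of l j] eq by auto
    moreover have "inj (($) (M k))"
      using closed_polyhedral_conforming[OF M] by (intro inj_verts conforming_orient_vec)
    ultimately show "x = y" using eq xy by (auto dest: injD)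
  qed
  have sym: "prod.swap ` range e = range e"
  proof -
    have sub: "prod.swap ` range e \<subseteq> range e"
    proof
      fix p assume "p \<in> prod.swap ` range e"
      then obtain k j where p: "p = (M k $ (j + 1), M k $ j)" by (auto simp: e_def)
      obtain l where "directed_edge (M l) (M k $ (j + 1)) (M k $ j)" using opp[OF de] by blast
      then obtain i where "M k $ (j + 1) = M l $ i" "M k $ j = M l $ (i + 1)"
        unfolding directed_edge_def by blast
      then have "p = e (l, i)" by (simp add: p e_def)
      then show "p \<in> range e" by simp
    qed
    then have "prod.swap ` prod.swap ` range e \<subseteq> prod.swap ` range e" by (rule image_mono)
    then show ?thesis using sub by (simp add: image_image)
  qed
  have "(\<Sum>k\<in>UNIV. \<Sum>j\<in>UNIV. g (M k $ j) (M k $ (j + 1))) = (\<Sum>x\<in>UNIV. case_prod g (e x))"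
    by (simp add: sum.cartesian_product e_def split_def)
  also have "\<dots> = (\<Sum>p\<in>range e. case_prod g p)" by (simp add: sum.reindex[OF inj])
  finally have 1: "(\<Sum>k\<in>UNIV. \<Sum>j\<in>UNIV. g (M k $ j) (M k $ (j + 1))) = (\<Sum>p\<in>range e. case_prod g p)" .
  have swap: "inj_on prod.swap (range e)" by (rule inj_onI) (metis swap_swap)
  have "(\<Sum>p\<in>range e. case_prod g p) = (\<Sum>p\<in>prod.swap ` range e. case_prod g p)" by (simp only: sym)
  also have "\<dots> = (\<Sum>p\<in>range e. case_prod g (prod.swap p))"
    by (simp only: sum.reindex[OF swap] o_def)
  also have "\<dots> = (\<Sum>p\<in>range e. - case_prod g p)"
    by (intro sum.cong refl) (simp add: split_def anti[of "fst _" "snd _"])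
  finally have "(\<Sum>p\<in>range e. case_prod g p) = - (\<Sum>p\<in>range e. case_prod g p)"
    by (simp add: sum_negf)
  then show ?thesis using 1 by simp
qed

text \<open>The directional derivative at \<open>T\<close>, in direction \<open>D\<close>, of the
  triple product of the three vertices.\<close>

definition volume_deriv :: "triangle \<Rightarrow> triangle \<Rightarrow> real" where
  "volume_deriv T D = D $ 1 \<bullet> cross3 (T $ 2) (T $ 3) + D $ 2 \<bullet> cross3 (T $ 3) (T $ 1)
     + D $ 3 \<bullet> cross3 (T $ 1) (T $ 2)"

text \<open>The two forms of the first variation of volume differ by edge terms only.\<close>

lemma sum_orient_vec_eq_volume_deriv:
  assumes M: "closed_polyhedral M"
  shows "(\<Sum>k\<in>UNIV. \<Sum>j\<in>UNIV. orient_vec (image_surf Z M k) \<bullet> D (M k $ j)) =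
    (\<Sum>k\<in>UNIV. volume_deriv (image_surf Z M k) (image_surf D M k))"
proof -
  \<comment> \<open>In the expansion of \<open>orient_vec\<close> into three cross products, each
    one paired with the opposite vertex gives \<open>volume_deriv\<close>; paired with its own two
    vertices it gives \<open>g\<close>.\<close>
  define g where "g a b = (D a + D b) \<bullet> cross3 (Z a) (Z b)" for a b
  have "g b a = - g a b" for a b
    unfolding g_def by (subst cross_skew) (simp add: add.commute)
  then have 0: "(\<Sum>k\<in>UNIV. \<Sum>j\<in>UNIV. g (M k $ j) (M k $ (j + 1))) = 0"
    by (rule sum_edges_eq_0[OF M])
  have idx: "(1::3) + 1 = 2" "(2::3) + 1 = 3" "(3::3) + 1 = 1" by simp_all
  have "(\<Sum>j\<in>UNIV. orient_vec (image_surf Z M k) \<bullet> D (M k $ j)) =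
      volume_deriv (image_surf Z M k) (image_surf D M k) + (\<Sum>j\<in>UNIV. g (M k $ j) (M k $ (j + 1)))" for k
    unfolding sum_3 idx orient_vec_sum volume_deriv_def g_def image_surf_nth
    by (simp add: inner_add_left inner_add_right inner_commute)
  then show ?thesis using 0 by (simp add: sum.distrib)
qed

text \<open>Simpson's rule is exact for the quadratic derivative of the cubic volume along a segment.\<close>

lemma simpson_volume:
  fixes A B :: triangle
  shows "volume_deriv A (B - A) + 4 * volume_deriv ((1/2) *\<^sub>R (A + B)) (B - A) + volume_deriv B (B - A) =
    6 * (B $ 1 \<bullet> cross3 (B $ 2) (B $ 3) - A $ 1 \<bullet> cross3 (A $ 2) (A $ 3))"
  unfolding volume_deriv_def by (simp add: cross3_def inner_vec_def sum_3 field_simps)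

lemma signed_volume_diff:
  assumes M: "closed_polyhedral M"
    and Y: "\<And>k. orient_vec (image_surf Y M k) \<noteq> 0"
  shows "signed_volume (image_surf (X (m + 1)) M) - signed_volume (image_surf (X m) M) =
    1/3 * (\<Sum>k\<in>UNIV. tri_area (image_surf Y M k) *
      (\<Sum>j\<in>UNIV. avg_normal M Y X m k \<bullet> (X (m + 1) (M k $ j) - X m (M k $ j))))"
proof -
  define D where "D x = X (m + 1) x - X m x" for x
  let ?V = "\<lambda>Z. \<Sum>k\<in>UNIV. \<Sum>j\<in>UNIV. orient_vec (image_surf Z M k) \<bullet> D (M k $ j)"
  let ?d = "\<lambda>T::triangle. T $ 1 \<bullet> cross3 (T $ 2) (T $ 3)"
  have half: "image_surf (half_step X m) M k =
      (1/2) *\<^sub>R (image_surf (X m) M k + image_surf (X (m + 1)) M k)" for k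
    by (simp add: vec_eq_iff half_step_def)
  have D: "image_surf D M k = image_surf (X (m + 1)) M k - image_surf (X m) M k" for k
    by (simp add: vec_eq_iff D_def)
  \<comment> \<open>The factor 1/12 is the 1/2 of the triangle area times the 1/6 of the averaged
    normal; the norm of the Jacobian of \<open>Y\<close> cancels.\<close>
  have eq: "tri_area (image_surf Y M k) * (\<Sum>j\<in>UNIV. avg_normal M Y X m k \<bullet> D (M k $ j)) =
      1/12 * ((\<Sum>j\<in>UNIV. orient_vec (image_surf (X m) M k) \<bullet> D (M k $ j))
        + 4 * (\<Sum>j\<in>UNIV. orient_vec (image_surf (half_step X m) M k) \<bullet> D (M k $ j))
        + (\<Sum>j\<in>UNIV. orient_vec (image_surf (X (m + 1)) M k) \<bullet> D (M k $ j)))" for k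
    using Y[of k] unfolding avg_normal_def tri_area_def
    by (simp add: inner_add_left sum.distrib flip: sum_distrib_left sum_divide_distrib)
  have "1/3 * (\<Sum>k\<in>UNIV. tri_area (image_surf Y M k) * (\<Sum>j\<in>UNIV. avg_normal M Y X m k \<bullet> D (M k $ j))) =
      1/36 * (?V (X m) + 4 * ?V (half_step X m) + ?V (X (m + 1)))"
    by (simp only: eq sum.distrib flip: sum_distrib_left)
  also have "\<dots> = 1/36 * (\<Sum>k\<in>UNIV. 6 * (?d (image_surf (X (m + 1)) M k) - ?d (image_surf (X m) M k)))"
    unfolding sum_orient_vec_eq_volume_deriv[OF M] unfolding half D simpson_volume[symmetric]
    by (simp add: sum.distrib sum_distrib_left)
  also have "\<dots> = signed_volume (image_surf (X (m + 1)) M) - signed_volume (image_surf (X m) M)"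
    unfolding signed_volume_def by (simp add: sum_subtractf diff_divide_distrib flip: sum_distrib_left)
  finally show ?thesis by (simp add: D_def)
qed

section \<open>The scheme\<close>

lemma proj_matrix_self: "proj_matrix \<nu> b *v b = 0"
proof -
  have "(\<chi> i j. b $ i * \<nu> $ j) *v b = (\<nu> \<bullet> b) *\<^sub>R b"
    by (simp add: vec_eq_iff matrix_vector_mult_def inner_vec_def sum_distrib_left mult_ac)
  then show ?thesis
    by (simp add: proj_matrix_def matrix_vector_mult_diff_rdistrib scaleR_matrix_vector_assoc[symmetric])
qed

lemma L2_prod_grad_const:
  assumes N: "conforming N" and f: "f \<in> pw_linear N" and c: "\<And>p. p \<in> vertices N \<Longrightarrow> f p = c"
  shows "L2_prod N F (grad N f) = 0"
proof -
  have "grad N f k x = 0" if "x \<in> tri (N k)" for k x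
    unfolding grad_def using pw_linear_const_on_tri[OF f] c that
    by (intro tri_grad_const[where c = c] conforming_orient_vec[OF N]) auto
  then show ?thesis unfolding L2_prod_def by (simp add: tri_integral_0)
qed

lemma L2_prod_grad_vec_const:
  assumes N: "conforming N" and f: "f \<in> pw_linear N" and c: "\<And>p. p \<in> vertices N \<Longrightarrow> f p = c"
  shows "L2_prod N F (grad_vec N f) = 0"
proof -
  have "tri_grad (N k) (\<lambda>y. f y $ i) x = 0" if "x \<in> tri (N k)" for k x i
    using pw_linear_const_on_tri[OF f] c that
    by (intro tri_grad_const[where c = "c $ i"] conforming_orient_vec[OF N]) auto
  then have "grad_vec N f k x = 0" if "x \<in> tri (N k)" for k x
    using that by (simp add: grad_vec_def vec_eq_iff)
  then show ?thesis unfolding L2_prod_def by (simp add: tri_integral_0)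
qed

text \<open>Testing the first equation with \<open>\<xi> = \<pi>\<^sub>h n\<close>, \<open>n\<close> the averaged normal: the stabilization
  term vanishes because \<open>\<pi>\<^sub>h n\<close> is in the kernel of the projection matrix, and the curvature term because
  the interpolated quotient is the constant \<open>1\<close>.\<close>

lemma scheme_step_volume_area:
  fixes M :: "'k::finite trisurf"
  assumes M: "closed_polyhedral M" and dt: "dt > 0"
    and X0: "parameterizes M (X m)" and X1: "parameterizes M (X (m + 1))" and Y: "parameterizes M Y"
    and nz: "normals_nonzero M Y X m"
    and step: "scheme_step M \<alpha> dt Y X m unew H lam"
  shows "enclosed_volume (image_surf (X (m + 1)) M) = enclosed_volume (image_surf (X m) M)"
    and "area (image_surf (X (m + 1)) M) \<le> area (image_surf (X m) M)"
proof -
  define G where "G = image_surf Y M"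
  define nb where "nb = lumped_proj G (avg_normal M Y X m)"
  define uold where "uold = lift_to M Y (X m)"
  have conf: "conforming M" using M by (rule closed_polyhedral_conforming)
  have G: "conforming G" unfolding G_def by (rule conforming_image_surf[OF conf Y])
  have nb: "nb \<in> pw_linear G" unfolding nb_def by (rule lumped_proj(1)[OF G])
  note step' = step[unfolded scheme_step_def Let_def, folded G_def, folded nb_def uold_def]
  have unew: "unew (Y x) = X (m + 1) x" if "x \<in> surface M" for x
    using step' that by simp
  have uold: "uold (Y x) = X m x" if "x \<in> surface M" for x
    using Y that by (simp add: uold_def lift_to_def parameterizes_def inv_into_f_f)
  have ar: "(area (image_surf (X (m + 1)) M) - area (image_surf (X m) M)) / dt
         + L2_prod G (grad G H) (grad G H) = 0"
    using step' by blast
  then have "(area (image_surf (X (m + 1)) M) - area (image_surf (X m) M)) / dt \<le> 0"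
    using L2_prod_self_nonneg[of G "grad G H"] by linarith
  then show "area (image_surf (X (m + 1)) M) \<le> area (image_surf (X m) M)"
    using dt by (simp add: divide_le_0_iff)
  \<comment> \<open>The weighted normal is kept abstract, because the matrix annihilates
    \<open>nb\<close> for every choice of its first argument.\<close>
  obtain \<nu>hat where "lumped_prod G (\<lambda>x. (1 / dt) *\<^sub>R (unew x - uold x)) nb
         + \<alpha> * L2_prod M (grad_vec M (half_step X m))
                (grad_vec M (interp M ((\<lambda>x. proj_matrix (\<nu>hat x) (nb x) *v nb x) \<circ> Y)))
         + lam * L2_prod G (grad G H) (grad G (interp G (\<lambda>x. (nb x \<bullet> nb x) / (norm (nb x))\<^sup>2))) = 0"
    using step' nb by blast
  moreover have "L2_prod M (grad_vec M (half_step X m))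
      (grad_vec M (interp M ((\<lambda>x. proj_matrix (\<nu>hat x) (nb x) *v nb x) \<circ> Y))) = 0"
    by (rule L2_prod_grad_vec_const[OF conf, where c = 0]) (auto intro!: interp_const simp: proj_matrix_self)
  moreover have "nb p \<noteq> 0" if "p \<in> vertices G" for p
    using nz that by (simp add: normals_nonzero_def Let_def nb_def G_def)
  then have "(nb p \<bullet> nb p) / (norm (nb p))\<^sup>2 = 1" if "p \<in> vertices G" for p
    using that by (simp add: power2_norm_eq_inner)
  then have "L2_prod G (grad G H) (grad G (interp G (\<lambda>x. (nb x \<bullet> nb x) / (norm (nb x))\<^sup>2))) = 0"
    by (intro L2_prod_grad_const[OF G, where c = 1] interp_const(1)[where c = 1] interp_const(2)[where c = 1])
  ultimately have "lumped_prod G (\<lambda>x. (1 / dt) *\<^sub>R (unew x - uold x)) nb = 0" by simp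
  \<comment> \<open>Symmetry of the lumped product moves the projected normal to the first slot,
    where its defining property can be applied.\<close>
  moreover have "lumped_prod G (\<lambda>x. (1 / dt) *\<^sub>R (unew x - uold x)) nb =
      1 / dt * lumped_prod G nb (\<lambda>x. unew x - uold x)"
    by (simp add: lumped_prod_def inner_commute flip: sum_divide_distrib)
  ultimately have "lumped_prod G nb (\<lambda>x. unew x - uold x) = 0" using dt by simp
  then have "1/3 * (\<Sum>k\<in>UNIV. tri_area (G k) *
      (\<Sum>j\<in>UNIV. avg_normal M Y X m k \<bullet> (X (m + 1) (M k $ j) - X m (M k $ j)))) = 0"
    unfolding nb_def lumped_proj(2)[OF G] by (simp add: G_def unew uold)
  then have "signed_volume (image_surf (X (m + 1)) M) = signed_volume (image_surf (X m) M)"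
    using signed_volume_diff[OF M conforming_orient_vec[OF G[unfolded G_def]], of X m] by (simp add: G_def)
  moreover have "enclosed_volume (image_surf Z M) = signed_volume (image_surf Z M)"
    if "parameterizes M Z" for Z
    using that by (intro enclosed_volume_eq_signed_volume conforming_image_surf conf)
      (auto simp: parameterizes_def)
  ultimately show "enclosed_volume (image_surf (X (m + 1)) M) = enclosed_volume (image_surf (X m) M)"
    using X0 X1 by simp
qed

theorem theorem2p5:
  fixes M :: "'k::finite trisurf"
    and \<alpha> Tfin :: real
    and t \<tau> :: "nat \<Rightarrow> real"
    and n :: nat
    and X u :: "nat \<Rightarrow> real^3 \<Rightarrow> real^3"
    and H :: "nat \<Rightarrow> real^3 \<Rightarrow> real"
    and lam :: "nat \<Rightarrow> real"
  assumes M: "closed_polyhedral M"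
    and alpha: "\<alpha> \<ge> 0"
    and partition: "t 0 = 0" "\<And>m. m < n \<Longrightarrow> t m < t (m + 1)" "t n = Tfin"
    and tau: "\<And>m. 1 \<le> m \<Longrightarrow> m \<le> n \<Longrightarrow> \<tau> m = t m - t (m - 1)"
    and surf: "\<And>m. m \<le> n \<Longrightarrow> parameterizes M (X m)"
    and surf_half: "\<And>m. m < n \<Longrightarrow> parameterizes M (half_step X m)"
    and surf_hat: "\<And>m. 1 \<le> m \<Longrightarrow> m < n \<Longrightarrow> parameterizes M (extrapolation \<tau> X m)"
    and nonzero_0: "0 < n \<Longrightarrow> normals_nonzero M (half_step X 0) X 0"
    and nonzero: "\<And>m. 1 \<le> m \<Longrightarrow> m < n \<Longrightarrow> normals_nonzero M (extrapolation \<tau> X m) X m"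
    and scheme_0: "0 < n \<Longrightarrow>
          scheme_step M \<alpha> (\<tau> 1) (half_step X 0) X 0 (u 1) (H 0) (lam 1)"
    and scheme: "\<And>m. 1 \<le> m \<Longrightarrow> m < n \<Longrightarrow>
          scheme_step M \<alpha> (\<tau> (m + 1)) (extrapolation \<tau> X m) X m (u (m + 1)) (H m) (lam (m + 1))"
  shows "\<forall>m<n.
      (\<forall>i\<le>m. enclosed_volume (image_surf (X (i + 1)) M) = enclosed_volume (image_surf (X i) M)) \<and>
      (\<forall>i\<le>m. area (image_surf (X (i + 1)) M) \<le> area (image_surf (X i) M))"
proof (intro allI impI conjI)
  have step: "enclosed_volume (image_surf (X (i + 1)) M) = enclosed_volume (image_surf (X i) M) \<and>
      area (image_surf (X (i + 1)) M) \<le> area (image_surf (X i) M)" if i: "i < n" for i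
  proof -
    have dt: "\<tau> (i + 1) > 0" using tau[of "i + 1"] partition(2)[OF i] i by simp
    have X: "parameterizes M (X i)" "parameterizes M (X (i + 1))" using surf i by simp_all
    show ?thesis
    proof (cases "i = 0")
      case True
      \<comment> \<open>The first step is the instance with the midpoint surface as
        \<open>Y\<close>; its facts are restated at \<open>0\<close> and \<open>0 + 1\<close> to
        match that instance.\<close>
      have n: "0 < n" and X': "parameterizes M (X 0)" "parameterizes M (X (0 + 1))"
        and dt': "\<tau> 1 > 0"
        using True i X dt by simp_all
      show ?thesis
        unfolding True
        using scheme_step_volume_area[OF M dt' X' surf_half[OF n] nonzero_0[OF n] scheme_0[OF n]] by blast
    next
      case False
      then have i1: "1 \<le> i" by simp
      show ?thesis
        using scheme_step_volume_area[OF M dt X surf_hat[OF i1 i] nonzero[OF i1 i] scheme[OF i1 i]] by blast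
    qed
  qed
  fix m i assume "m < n" "i \<le> m"
  then have "i < n" by simp
  then show "enclosed_volume (image_surf (X (i + 1)) M) = enclosed_volume (image_surf (X i) M)"
    and "area (image_surf (X (i + 1)) M) \<le> area (image_surf (X i) M)"
    using step by blast+
qed

end
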